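(* Let $k$ be an algebraically closed field of characteristic $p>0$, let $\mathfrak{m}=\langle x,y\rangle\subset k[[x,y]]$, let $f\in\mathfrak{m}^2$ be irreducible in $k[[x,y]]$, and let $\beta_0,\beta_1$ be the first two elements of the minimal generating sequence of the semigroup of values $\Gamma(f)$. Then: (1) $\operatorname{fpt}(f)\leq\frac{1}{\beta_0}+\frac{1}{\beta_1}$. (2) If $\Gamma(f)=\langle\beta_0,\beta_1\rangle$ (i.e. $\Gamma(f)$ is generated as a semigroup by $\beta_0$ and $\beta_1$), then $$\operatorname{fpt}(x^{\beta_0}+y^{\beta_1})\leq\operatorname{fpt}(f)\leq\frac{1}{\beta_0}+\frac{1}{\beta_1}.$$ In particular, if moreover $\operatorname{fpt}(x^{\beta_0}+y^{\beta_1})=\frac{1}{\beta_0}+\frac{1}{\beta_1}$, then $\operatorname{fpt}(f)=\operatorname{fpt}(x^{\beta_0}+y^{\beta_1})$.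
   Context: For an irreducible $f\in k[[x,y]]$, the semigroup of values is $\Gamma(f)=\{\, i(f,g) : g\in k[[x,y]]\setminus\langle f\rangle\,\}$, where $i(f,g)=\dim_k\big(k[[x,y]]/\langle f,g\rangle\big)$. It is a numerical semigroup. Its minimal generating sequence $\beta_0,\beta_1,\dots,\beta_K$ is defined by $\beta_0=\min(\Gamma(f)\setminus\{0\})$ and $\beta_{i+1}=\min\big(\Gamma(f)\setminus(\beta_0\mathbb{N}+\cdots+\beta_i\mathbb{N})\big)$ (with $0\in\mathbb{N}$), continued until the set is empty; it is finite, and when $f\in\mathfrak{m}^2$ it has at least two elements. For $e\ge 0$, $\mathfrak{m}^{[p^e]}=\langle x^{p^e},y^{p^e}\rangle$. For $h\in\mathfrak{m}$, let $\nu_e(h)$ be the largest integer $N\geq 0$ such that $h^N\notin\mathfrak{m}^{[p^e]}$; the $F$-pure threshold of $h$ is $\operatorname{fpt}(h)=\lim_{e\to\infty}\nu_e(h)/p^e$ (the limit exists). *)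

theory Defs
  imports
    "HOL-Computational_Algebra.Computational_Algebra"
    "HOL-Library.Extended_Nat"
begin

text \<open>
  The ring $k[[x,y]]$ is taken to be $k[[x]][[y]]$: the coefficient of $x^i y^j$ in \<open>F\<close> is
  \<open>fps_nth (fps_nth F j) i\<close>.
\<close>

type_synonym 'k fps2 = "'k fps fps"

definition var_x :: "'k::comm_ring_1 fps2" where
  "var_x = fps_const fps_X"

definition var_y :: "'k::comm_ring_1 fps2" where
  "var_y = fps_X"

definition scalar :: "'k::comm_ring_1 \<Rightarrow> 'k fps2 \<Rightarrow> 'k fps2" where
  "scalar c F = fps_const (fps_const c) * F"

definition ideal_gen :: "'a::comm_ring_1 set \<Rightarrow> 'a set" where
  "ideal_gen S = module.span (*) S"

lemma ideal_gen_insert2: "ideal_gen {a, b} = {r * a + s * b | r s. True}"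
proof -
  interpret module "(*) :: 'a \<Rightarrow> 'a \<Rightarrow> 'a"
    by unfold_locales (simp_all add: algebra_simps)
  show ?thesis
    unfolding ideal_gen_def
    by (auto simp: span_insert algebra_simps span_singleton)
qed

definition max_ideal :: "'k::comm_ring_1 fps2 set" where
  "max_ideal = ideal_gen {var_x, var_y}"

definition max_ideal_sq :: "'k::comm_ring_1 fps2 set" where
  "max_ideal_sq = ideal_gen {a * b | a b. a \<in> max_ideal \<and> b \<in> max_ideal}"


text \<open>
  \<open>quotient_basis W B\<close> says that the classes of the elements of the finite set \<open>B\<close> are pairwise
  distinct and form a $k$-basis of $k[[x,y]]/W$.
\<close>

definition quotient_basis :: "'k::field fps2 set \<Rightarrow> 'k fps2 set \<Rightarrow> bool" where
  "quotient_basis W B \<longleftrightarrow> finite B \<and>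
     (\<forall>c. (\<Sum>b\<in>B. scalar (c b) b) \<in> W \<longrightarrow> (\<forall>b\<in>B. c b = 0)) \<and>
     (\<forall>v. \<exists>c. v - (\<Sum>b\<in>B. scalar (c b) b) \<in> W)"

text \<open>
  All bases have the same cardinality, so the infimum only serves to select it; it is \<open>\<infinity>\<close>
  (infimum of the empty set) when the quotient is not finite dimensional.
\<close>

definition quotient_dim :: "'k::field fps2 set \<Rightarrow> enat" where
  "quotient_dim W = Inf {enat (card B) | B. quotient_basis W B}"

definition intersection_mult :: "'k::field fps2 \<Rightarrow> 'k fps2 \<Rightarrow> enat" where
  "intersection_mult f g = quotient_dim (ideal_gen {f, g})"

definition value_semigroup :: "'k::field fps2 \<Rightarrow> nat set" where
  "value_semigroup f = {n. \<exists>g. g \<notin> ideal_gen {f} \<and> intersection_mult f g = enat n}"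


definition nat_span :: "nat set \<Rightarrow> nat set" where
  "nat_span S = {(\<Sum>b\<in>T. c b * b) | T c. finite T \<and> T \<subseteq> S}"

text \<open>
  Since \<open>nat_span {} = {0}\<close>, the case \<open>i = 0\<close> gives the least nonzero element. The value is
  meaningful only as long as \<open>\<Gamma>\<close> is not contained in the span of the earlier terms.
\<close>

fun min_gen_seq :: "nat set \<Rightarrow> nat \<Rightarrow> nat" where
  "min_gen_seq \<Gamma> i = (LEAST n. n \<in> \<Gamma> - nat_span (min_gen_seq \<Gamma> ` {..<i}))"

declare min_gen_seq.simps [simp del]


definition frob_power :: "nat \<Rightarrow> 'k::field fps2 set" where
  "frob_power e = ideal_gen {var_x ^ (CHAR('k) ^ e), var_y ^ (CHAR('k) ^ e)}"

definition nu :: "nat \<Rightarrow> 'k::field fps2 \<Rightarrow> nat" where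
  "nu e h = (GREATEST N. h ^ N \<notin> frob_power e)"

definition fpt :: "'k::field fps2 \<Rightarrow> real" where
  "fpt h = lim (\<lambda>e. real (nu e h) / real (CHAR('k) ^ e))"

end

theory Submission
  imports Defs
begin

text \<open>
  Blowing up repeatedly shows that every nonunit $f \neq 0$ vanishes on some nonconstant
  formal arc $k[[x,y]] \to k[[t]]$. If $f$ is irreducible, the kernel of the arc is $\langle f \rangle$, and
  the order in $t$, divided by the period $d$ of the semigroup of orders, is the intersection
  multiplicity with $f$: both count the values of $f$ that are not $i(f,g)$ plus a value.

  Subtracting from $y$ a suitable series in $x$ gives coordinates with $i(f,x) = \beta_0$ and
  $i(f,y) = \beta_1$. Give $x$, $y$ the weights $\beta_0$, $\beta_1$. Counting dimensions modulo the
  elements of value at least $M$, for large $M$, shows that all monomials of $f$ have weight at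
  least $\beta_0\beta_1$; if $\Gamma(f) = \langle\beta_0,\beta_1\rangle$, the part of weight
  $\beta_0\beta_1$ is $c x^{\beta_1} + d y^{\beta_0}$ with $c, d \neq 0$. Both bounds on
  $\operatorname{fpt}(f)$ are then read off from the monomials of $f^N$ outside
  $\mathfrak{m}^{[p^e]}$.
\<close>

unbundle fps_syntax

section \<open>Coefficients and homomorphisms\<close>

text \<open>In positive characteristic an expansion of y in fractional powers of x may fail to
  exist, which is why the arc is sought through infinitely near points. For a single arc a dichotomy
  is enough: either some blow-up lowers the multiplicity and induction applies, or the multiplicity
  stays the same forever, and then the successive centres are the coefficients of a smooth arc.

  After that the arc is used only through the sets of series whose order along it is at least a
  given bound. The properties recorded for this filtration (values add, graded pieces are at most
  one-dimensional, the intersection is the ideal of f, almost all integers are values) carry the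
  whole theory of values, and they pass unchanged through coordinate changes. Limits are replaced
  throughout by identities with explicit remainders divisible by powers of x.

  The constant \<open>a * b\<close> comes from comparing two growth rates: almost every integer is a
  value, while the monomials that survive modulo f, ordered by weight, have density W/(ab) if f has
  an initial form of weight W.\<close>

definition cst :: "'k::comm_ring_1 \<Rightarrow> 'k fps2" where
  "cst c = fps_const (fps_const c)"

lemma cst_nth: "cst c $ j $ i = (if i = 0 \<and> j = 0 then c else 0)"
  by (simp add: cst_def)

lemma cst_mult_nth [simp]: "(cst c * F) $ j $ i = c * F $ j $ i"
  by (simp add: cst_def)

lemma cst_simps:
  "cst 0 = 0" "cst 1 = 1" "cst (a + b) = cst a + cst b" "cst (a * b) = cst a * cst b"
  "cst (- a) = - cst a" "cst (a - b) = cst a - cst b"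
  by (simp_all add: cst_def)

lemma scalar_conv_cst: "scalar c F = cst c * F"
  by (simp add: scalar_def cst_def)

lemma var_x_power: "var_x ^ n = fps_const (fps_X ^ n)"
  by (simp add: var_x_def fps_const_power)

lemma var_x_power_mult_nth:
  "(var_x ^ n * F) $ j $ i = (if i < n then 0 else F $ j $ (i - n))"
  by (simp add: var_x_power fps_X_power_mult_nth)

lemma var_y_power_mult_nth:
  "(var_y ^ n * F) $ j $ i = (if j < n then 0 else F $ (j - n) $ i)"
  by (simp add: var_y_def fps_X_power_mult_nth)

lemma var_x_mult_nth: "(var_x * F) $ j $ i = (if i = 0 then 0 else F $ j $ (i - 1))"
  using var_x_power_mult_nth[of 1 F j i] by simp

lemma var_y_mult_nth: "(var_y * F) $ j $ i = (if j = 0 then 0 else F $ (j - 1) $ i)"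
  using var_y_power_mult_nth[of 1 F j i] by simp

lemma var_x_nth: "(var_x :: 'k::comm_ring_1 fps2) $ j $ i = (if i = 1 \<and> j = 0 then 1 else 0)"
  by (simp add: var_x_def)

lemma var_y_nth: "(var_y :: 'k::comm_ring_1 fps2) $ j $ i = (if i = 0 \<and> j = 1 then 1 else 0)"
  by (simp add: var_y_def)

lemma fps2_eqI: "(\<And>i j. F $ j $ i = G $ j $ i) \<Longrightarrow> F = (G :: 'k fps2)"
  by (simp add: fps_eq_iff)

lemma monom_nth:
  "(var_x ^ a * var_y ^ b :: 'k::comm_ring_1 fps2) $ j $ i = (if i = a \<and> j = b then 1 else 0)"
  by (auto simp: var_x_power var_y_def)

text \<open>Together with \<open>low_y\<close> this splits off the constant term asymmetrically:
  monomials divisible by y go to \<open>low_y\<close>, and only the pure powers of x are left for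
  \<open>low_x\<close>. No monomial is used twice, so nothing cancels and a weight drops by that of
  the variable only.\<close>

definition low_x :: "'k::comm_ring_1 fps2 \<Rightarrow> 'k fps2" where
  "low_x F = fps_const (fps_shift 1 (F $ 0))"

definition low_y :: "'k::comm_ring_1 fps2 \<Rightarrow> 'k fps2" where
  "low_y F = fps_shift 1 F"

lemma low_decomp: "F = cst (F $ 0 $ 0) + var_x * low_x F + var_y * low_y F"
proof (rule fps2_eqI)
  fix i j
  show "F $ j $ i = (cst (F $ 0 $ 0) + var_x * low_x F + var_y * low_y F) $ j $ i"
    by (simp only: fps_add_nth cst_nth var_x_mult_nth var_y_mult_nth) (simp add: low_x_def low_y_def)
qed

section \<open>Weight filtrations and powers of the maximal ideal\<close>

definition wt_ge :: "nat \<Rightarrow> nat \<Rightarrow> nat \<Rightarrow> 'k::comm_ring_1 fps2 set" where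
  "wt_ge a b W = {F. \<forall>i j. a * i + b * j < W \<longrightarrow> F $ j $ i = 0}"

abbreviation ord_ge :: "nat \<Rightarrow> 'k::comm_ring_1 fps2 set" where
  "ord_ge \<equiv> wt_ge 1 1"

lemma wt_geI: "(\<And>i j. a * i + b * j < W \<Longrightarrow> F $ j $ i = 0) \<Longrightarrow> F \<in> wt_ge a b W"
  by (simp add: wt_ge_def)

lemma wt_geD: "F \<in> wt_ge a b W \<Longrightarrow> a * i + b * j < W \<Longrightarrow> F $ j $ i = 0"
  by (simp add: wt_ge_def)

lemma wt_ge_0 [simp]: "F \<in> wt_ge a b 0" "0 \<in> wt_ge a b W"
  by (simp_all add: wt_ge_def)

lemma wt_ge_add: "F \<in> wt_ge a b W \<Longrightarrow> G \<in> wt_ge a b W \<Longrightarrow> F + G \<in> wt_ge a b W"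
  by (simp add: wt_ge_def)

lemma wt_ge_diff: "F \<in> wt_ge a b W \<Longrightarrow> G \<in> wt_ge a b W \<Longrightarrow> F - G \<in> wt_ge a b W"
  by (simp add: wt_ge_def)

lemma wt_ge_mono: "F \<in> wt_ge a b W \<Longrightarrow> V \<le> W \<Longrightarrow> F \<in> wt_ge a b V"
  by (auto simp: wt_ge_def)

lemma wt_ge_mult:
  assumes "F \<in> wt_ge a b V" "G \<in> wt_ge a b W"
  shows "F * G \<in> wt_ge a b (V + W)"
proof (rule wt_geI)
  fix i j assume ij: "a * i + b * j < V + W"
  have "F $ l $ k * G $ (j - l) $ (i - k) = 0" if "l \<le> j" "k \<le> i" for k l
  proof (rule ccontr)
    assume "F $ l $ k * G $ (j - l) $ (i - k) \<noteq> 0"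
    hence "F $ l $ k \<noteq> 0" "G $ (j - l) $ (i - k) \<noteq> 0" by auto
    hence "\<not> a * k + b * l < V" "\<not> a * (i - k) + b * (j - l) < W"
      using assms wt_geD by blast+
    hence "V + W \<le> (a * k + b * l) + (a * (i - k) + b * (j - l))" by linarith
    also have "\<dots> = a * (k + (i - k)) + b * (l + (j - l))" by (simp only: algebra_simps)
    also have "\<dots> = a * i + b * j" using that by simp
    finally show False using ij by simp
  qed
  thus "(F * G) $ j $ i = 0"
    by (simp add: fps_mult_nth fps_sum_nth)
qed

lemma wt_ge_mult_right: "F \<in> wt_ge a b V \<Longrightarrow> F * G \<in> wt_ge a b V"
  using wt_ge_mult[of F a b V G 0] by simp

lemma wt_ge_mult_left: "G \<in> wt_ge a b V \<Longrightarrow> F * G \<in> wt_ge a b V"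
  using wt_ge_mult[of F a b 0 G V] by simp

lemma wt_ge_sum: "(\<And>s. s \<in> S \<Longrightarrow> F s \<in> wt_ge a b W) \<Longrightarrow> sum F S \<in> wt_ge a b W"
  by (induction S rule: infinite_finite_induct) (auto intro: wt_ge_add)

lemma wt_ge_power: "F \<in> wt_ge a b W \<Longrightarrow> F ^ n \<in> wt_ge a b (n * W)"
  by (induction n) (auto intro: wt_ge_mult)

lemma wt_ge_var: "var_x \<in> wt_ge a b a" "var_y \<in> wt_ge a b b"
  by (auto simp: wt_ge_def var_x_nth var_y_nth)

lemma wt_ge_low:
  assumes "F \<in> wt_ge a b W"
  shows "low_x F \<in> wt_ge a b (W - a)" "low_y F \<in> wt_ge a b (W - b)"
  using assms by (auto simp: wt_ge_def low_x_def low_y_def)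

lemma ord_ge_eq_0: "(\<And>n. F \<in> ord_ge n) \<Longrightarrow> F = 0"
proof (rule fps2_eqI)
  fix i j assume "\<And>n. F \<in> ord_ge n"
  from wt_geD[OF this, of i j "Suc (i + j)"] show "F $ j $ i = 0 $ j $ i" by simp
qed

lemma ord_ge_Suc_decomp:
  assumes "F \<in> ord_ge (Suc n)"
  obtains A B where "F = var_x * A + var_y * B" "A \<in> ord_ge n" "B \<in> ord_ge n"
proof
  have "F $ 0 $ 0 = 0" using wt_geD[OF assms, of 0 0] by simp
  thus "F = var_x * low_x F + var_y * low_y F"
    using low_decomp[of F] by (simp add: cst_simps)
  show "low_x F \<in> ord_ge n" "low_y F \<in> ord_ge n"
    using wt_ge_low[OF assms] by simp_all
qed

lemma max_ideal_iff: "F \<in> max_ideal \<longleftrightarrow> F $ 0 $ 0 = 0"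
proof
  assume "F \<in> max_ideal"
  thus "F $ 0 $ 0 = 0"
    by (auto simp: max_ideal_def ideal_gen_insert2 mult.commute[of _ var_x] mult.commute[of _ var_y]
        var_x_nth var_y_nth)
next
  assume "F $ 0 $ 0 = 0"
  hence "F = low_x F * var_x + low_y F * var_y"
    using low_decomp[of F] by (simp add: cst_simps mult.commute)
  thus "F \<in> max_ideal"
    unfolding max_ideal_def ideal_gen_insert2 by blast
qed

lemma max_ideal_sq_ord_ge:
  assumes "F \<in> max_ideal_sq"
  shows "F \<in> ord_ge 2"
proof -
  interpret module "(*) :: 'a fps2 \<Rightarrow> 'a fps2 \<Rightarrow> 'a fps2"
    by unfold_locales (simp_all add: algebra_simps)
  have *: "subspace (ord_ge 2 :: 'a fps2 set)"
    unfolding subspace_def by (auto intro: wt_ge_add wt_ge_mult_left)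
  have "{a * b | a b. a \<in> max_ideal \<and> b \<in> max_ideal} \<subseteq> (ord_ge 2 :: 'a fps2 set)"
  proof clarify
    fix a b :: "'a fps2" assume "a \<in> max_ideal" "b \<in> max_ideal"
    hence "a \<in> ord_ge 1" "b \<in> ord_ge 1" by (auto simp: max_ideal_iff wt_ge_def)
    from wt_ge_mult[OF this] show "a * b \<in> ord_ge 2" by (simp add: numeral_2_eq_2)
  qed
  from span_minimal[OF this *] show ?thesis
    using assms by (auto simp: max_ideal_sq_def ideal_gen_def)
qed

lemma unit_fps2_iff: "(F :: 'k::field fps2) dvd 1 \<longleftrightarrow> F $ 0 $ 0 \<noteq> 0"
proof
  assume "F dvd 1"
  then obtain G where "1 = F * G" by (elim dvdE)
  hence "(F * G) $ 0 $ 0 = 1" by (metis fps_one_nth)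
  thus "F $ 0 $ 0 \<noteq> 0" by auto
next
  assume "F $ 0 $ 0 \<noteq> 0"
  hence "F $ 0 dvd 1" by (simp add: fps_is_unit_iff)
  then obtain u where "F $ 0 * u = 1" by (metis dvdE)
  from fps_right_inverse[OF this] show "F dvd 1" by (metis dvdI)
qed

section \<open>Algebra endomorphisms and substitution\<close>

definition alg_hom :: "('k::comm_ring_1 fps2 \<Rightarrow> 'k fps2) \<Rightarrow> bool" where
  "alg_hom \<theta> \<longleftrightarrow> (\<forall>F G. \<theta> (F + G) = \<theta> F + \<theta> G) \<and> (\<forall>F G. \<theta> (F * G) = \<theta> F * \<theta> G) \<and>
     (\<forall>c. \<theta> (cst c) = cst c)"

lemma alg_hom_simps:
  assumes "alg_hom \<theta>"
  shows "\<theta> (F + G) = \<theta> F + \<theta> G" "\<theta> (F * G) = \<theta> F * \<theta> G" "\<theta> (cst c) = cst c"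
    "\<theta> 0 = 0" "\<theta> 1 = 1" "\<theta> (- F) = - \<theta> F" "\<theta> (F - G) = \<theta> F - \<theta> G" "\<theta> (F ^ n) = \<theta> F ^ n"
proof -
  show *: "\<theta> (F + G) = \<theta> F + \<theta> G" "\<theta> (F * G) = \<theta> F * \<theta> G" "\<theta> (cst c) = cst c" for F G c
    using assms by (simp_all add: alg_hom_def)
  show **: "\<theta> 0 = 0" "\<theta> 1 = 1" using *(3)[of 0] *(3)[of 1] by (simp_all add: cst_simps)
  have "\<theta> (- F) = - \<theta> F" for F using *(1)[of F "- F"] ** by (simp add: eq_neg_iff_add_eq_0 add.commute)
  thus "\<theta> (- F) = - \<theta> F" "\<theta> (F - G) = \<theta> F - \<theta> G"
    using *(1)[of F "- G"] by simp_all
  show "\<theta> (F ^ n) = \<theta> F ^ n" by (induction n) (simp_all add: * **)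
qed

lemma alg_hom_comp: "alg_hom \<theta> \<Longrightarrow> alg_hom \<eta> \<Longrightarrow> alg_hom (\<lambda>F. \<theta> (\<eta> F))"
  by (simp add: alg_hom_def)

lemma alg_hom_ord_ge:
  assumes "alg_hom \<theta>" "\<theta> var_x \<in> ord_ge 1" "\<theta> var_y \<in> ord_ge 1" "F \<in> ord_ge n"
  shows "\<theta> F \<in> ord_ge n"
  using assms(4)
proof (induction n arbitrary: F)
  case (Suc n)
  from Suc.prems obtain A B where AB: "F = var_x * A + var_y * B" "A \<in> ord_ge n" "B \<in> ord_ge n"
    by (rule ord_ge_Suc_decomp)
  have "\<theta> var_x * \<theta> A \<in> ord_ge (1 + n)" "\<theta> var_y * \<theta> B \<in> ord_ge (1 + n)"
    by (intro wt_ge_mult assms Suc AB)+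
  thus ?case using AB by (simp add: alg_hom_simps[OF assms(1)] wt_ge_add)
qed simp

text \<open>Continuity comes for free: the maps agree on constants, and every variable split off
  from F gains one order because its image lies in the maximal ideal. The difference therefore has
  infinite order.\<close>

lemma alg_hom_unique:
  assumes "alg_hom \<theta>" "alg_hom \<eta>"
    and xy: "\<theta> var_x = \<eta> var_x" "\<theta> var_y = \<eta> var_y"
    and loc: "\<theta> var_x \<in> ord_ge 1" "\<theta> var_y \<in> ord_ge 1"
  shows "\<theta> F = \<eta> F"
proof -
  have "\<theta> F - \<eta> F \<in> ord_ge n" for n
  proof (induction n arbitrary: F)
    case (Suc n)
    define c A B where "c = F $ 0 $ 0" "A = low_x F" "B = low_y F"
    have F: "F = cst c + var_x * A + var_y * B"
      unfolding c_A_B_def by (rule low_decomp)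
    have "\<theta> F - \<eta> F = \<theta> var_x * (\<theta> A - \<eta> A) + \<theta> var_y * (\<theta> B - \<eta> B)"
      by (simp add: F alg_hom_simps[OF assms(1)] alg_hom_simps[OF assms(2)] xy algebra_simps)
    also have "\<dots> \<in> ord_ge (1 + n)"
      by (intro wt_ge_add wt_ge_mult loc Suc)
    finally show ?case by simp
  qed simp
  from ord_ge_eq_0[OF this] show ?thesis by simp
qed

text \<open>Horner's scheme for F(x, Y). If Y lies in the maximal ideal, n steps determine the
  result up to order n, so \<open>subst_y\<close> can read off the coefficient of x^i y^j after i +
  j + 1 steps.\<close>

fun subst_y_approx :: "'k::comm_ring_1 fps2 \<Rightarrow> nat \<Rightarrow> 'k fps2 \<Rightarrow> 'k fps2" where
  "subst_y_approx Y 0 F = 0"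
| "subst_y_approx Y (Suc n) F = fps_const (F $ 0) + Y * subst_y_approx Y n (fps_shift 1 F)"

definition subst_y :: "'k::comm_ring_1 fps2 \<Rightarrow> 'k fps2 \<Rightarrow> 'k fps2" where
  "subst_y Y F = Abs_fps (\<lambda>j. Abs_fps (\<lambda>i. subst_y_approx Y (Suc (i + j)) F $ j $ i))"

lemma subst_y_approx_add:
  "subst_y_approx Y n (F + G) = subst_y_approx Y n F + subst_y_approx Y n G"
  by (induction n arbitrary: F G) (simp_all add: fps_shift_add algebra_simps)

lemma subst_y_approx_const_mult:
  "subst_y_approx Y n (fps_const c * G) = fps_const c * subst_y_approx Y n G"
proof (induction n arbitrary: G)
  case (Suc n)
  have "fps_shift 1 (fps_const c * G) = fps_const c * fps_shift 1 G"
    by (simp add: fps_eq_iff)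
  thus ?case by (simp add: Suc algebra_simps)
qed simp

lemma subst_y_approx_Suc:
  assumes "Y \<in> ord_ge 1"
  shows "subst_y_approx Y (Suc n) F - subst_y_approx Y n F \<in> ord_ge n"
proof (induction n arbitrary: F)
  case (Suc n)
  have "subst_y_approx Y (Suc (Suc n)) F - subst_y_approx Y (Suc n) F =
    Y * (subst_y_approx Y (Suc n) (fps_shift 1 F) - subst_y_approx Y n (fps_shift 1 F))"
    by (simp add: algebra_simps)
  also have "\<dots> \<in> ord_ge (1 + n)" by (intro wt_ge_mult assms Suc)
  finally show ?case by simp
qed simp

lemma subst_y_approx_mult:
  assumes Y: "Y \<in> ord_ge 1"
  shows "subst_y_approx Y n (F * G) - subst_y_approx Y n F * subst_y_approx Y n G \<in> ord_ge n"
proof (induction n arbitrary: F)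
  case (Suc n)
  let ?s = "subst_y_approx Y" and ?F = "fps_shift 1 F"
  have F: "F * G = fps_const (F $ 0) * G + fps_X * (?F * G)"
  proof -
    have "F = fps_const (F $ 0) + fps_X * ?F"
      by (rule fps_ext) simp
    thus ?thesis by (metis distrib_right mult.assoc)
  qed
  have X: "?s (Suc n) (fps_X * H) = Y * ?s n H" for H
  proof -
    have "fps_shift 1 (fps_X * H) = H" by (rule fps_ext) simp
    thus ?thesis by simp
  qed
  \<comment> \<open>The product contains G at level n + 1, the induction hypothesis at level n. The
    two levels differ in order n, and the factor Y supplies the missing order.\<close>
  have "?s (Suc n) (F * G) - ?s (Suc n) F * ?s (Suc n) G =
     Y * (?s n (?F * G) - ?s n ?F * ?s n G) - Y * (?s n ?F * (?s (Suc n) G - ?s n G))"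
    by (subst F, subst subst_y_approx_add, subst X, subst subst_y_approx_const_mult)
       (simp add: algebra_simps)
  also have "\<dots> \<in> ord_ge (1 + n)"
    by (intro wt_ge_diff wt_ge_mult[OF Y] Suc wt_ge_mult_left subst_y_approx_Suc Y)
  finally show ?case by simp
qed simp

lemma subst_y_cong:
  assumes "Y \<in> ord_ge 1"
  shows "subst_y Y F - subst_y_approx Y n F \<in> ord_ge n"
proof -
  have *: "subst_y_approx Y (n + k) F - subst_y_approx Y n F \<in> ord_ge n" for n k
  proof (induction k)
    case (Suc k)
    have "subst_y_approx Y (Suc (n + k)) F - subst_y_approx Y (n + k) F \<in> ord_ge n"
      using subst_y_approx_Suc[OF assms, of "n + k" F] by (rule wt_ge_mono) simp
    from wt_ge_add[OF this Suc] show ?case by (simp del: subst_y_approx.simps)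
  qed simp
  show ?thesis
  proof (rule wt_geI)
    fix i j assume "1 * i + 1 * j < n"
    hence "n = Suc (i + j) + (n - Suc (i + j))" by simp
    then obtain k where n: "n = Suc (i + j) + k" by blast
    from wt_geD[OF *[where n = "Suc (i + j)" and k = k], of i j] show "(subst_y Y F - subst_y_approx Y n F) $ j $ i = 0"
      unfolding n by (simp add: subst_y_def del: subst_y_approx.simps)
  qed
qed

lemma subst_y_const: "subst_y Y (fps_const c) = fps_const c"
proof (rule fps2_eqI)
  fix i j
  have "subst_y_approx Y n 0 = 0" for n by (induction n) simp_all
  hence "subst_y_approx Y (Suc n) (fps_const c) = fps_const c" for n
    by (simp add: fps_shift_fps_const)
  thus "subst_y Y (fps_const c) $ j $ i = fps_const c $ j $ i"
    by (simp only: subst_y_def fps_nth_Abs_fps)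
qed

lemma subst_y:
  assumes Y: "Y \<in> ord_ge 1"
  shows "alg_hom (subst_y Y)" "subst_y Y var_x = var_x" "subst_y Y var_y = Y"
proof -
  let ?s = "subst_y Y" and ?a = "subst_y_approx Y"
  have eqI: "F = G" if "\<And>n. (F - ?a n H) + (?a n H - G) \<in> ord_ge n" for F G H
    using ord_ge_eq_0[of "F - G"] that by simp
  note const = subst_y_const[of Y]
  have add: "?s (F + G) = ?s F + ?s G" for F G
    by (rule fps2_eqI) (simp add: subst_y_def subst_y_approx_add del: subst_y_approx.simps)
  have mult: "?s (F * G) = ?s F * ?s G" for F G
  proof (rule eqI)
    fix n
    have "?a n (F * G) - ?s F * ?s G = (?a n (F * G) - ?a n F * ?a n G)
      - ((?s F - ?a n F) * ?s G + ?a n F * (?s G - ?a n G))"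
      by (simp add: algebra_simps)
    also have "\<dots> \<in> ord_ge n"
      by (intro wt_ge_add wt_ge_diff wt_ge_mult_left wt_ge_mult_right subst_y_cong Y subst_y_approx_mult)
    finally show "(?s (F * G) - ?a n (F * G)) + (?a n (F * G) - ?s F * ?s G) \<in> ord_ge n"
      by (intro wt_ge_add subst_y_cong Y)
  qed
  show "alg_hom ?s"
    unfolding alg_hom_def using add mult const by (simp add: cst_def)
  show "?s var_x = var_x" by (simp add: var_x_def const)
  show "?s var_y = Y"
  proof (rule fps2_eqI)
    fix i j
    have z: "?a n 0 = 0" for n by (induction n) simp_all
    have o: "fps_shift 1 (fps_X :: 'a fps2) = 1" by (simp add: fps_eq_iff)
    have "?a (Suc (Suc n)) var_y = Y" for n
      using z by (simp add: var_y_def o fps_shift_one)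
    hence *: "?a (Suc (i + j)) var_y = Y" if "i + j \<noteq> 0" using that by (cases "i + j") (auto simp del: subst_y_approx.simps)
    show "?s var_y $ j $ i = Y $ j $ i"
    proof (cases "i + j = 0")
      case True
      thus ?thesis using wt_geD[OF Y, of 0 0] by (simp add: subst_y_def var_y_def)
    next
      case False
      thus ?thesis by (simp add: subst_y_def * del: subst_y_approx.simps)
    qed
  qed
qed

definition swap_xy :: "'k::comm_ring_1 fps2 \<Rightarrow> 'k fps2" where
  "swap_xy F = Abs_fps (\<lambda>j. Abs_fps (\<lambda>i. F $ i $ j))"

lemma swap_xy:
  fixes F :: "'k::comm_ring_1 fps2"
  shows "alg_hom (swap_xy :: 'k fps2 \<Rightarrow> _)" "swap_xy (var_x :: 'k fps2) = var_y"
    "swap_xy (var_y :: 'k fps2) = var_x" "swap_xy (swap_xy F) = F"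
proof -
  have "swap_xy (F * G) = swap_xy F * swap_xy G" for F G :: "'k fps2"
    by (rule fps2_eqI) (simp add: swap_xy_def fps_mult_nth fps_sum_nth, rule sum.swap)
  thus "alg_hom (swap_xy :: 'k fps2 \<Rightarrow> _)"
    unfolding alg_hom_def by (auto intro!: fps2_eqI simp: swap_xy_def cst_nth)
  show "swap_xy (var_x :: 'k fps2) = var_y" "swap_xy (var_y :: 'k fps2) = var_x" "swap_xy (swap_xy F) = F"
    by (rule fps2_eqI, simp add: swap_xy_def var_x_nth var_y_nth)+
qed

section \<open>Completeness in x\<close>

text \<open>The infinite sum S of the q_k x^k is handled through its remainder after every n. With
  \<open>x_adic_eq_0\<close> this turns a division repeated indefinitely into an exact
  identity.\<close>

lemma x_adic_limit:
  fixes q :: "nat \<Rightarrow> 'k::comm_ring_1 fps2"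
  obtains S r where "\<And>n. S = (\<Sum>k<n. q k * var_x ^ k) + var_x ^ n * r n"
proof -
  define r where "r n = Abs_fps (\<lambda>j. Abs_fps (\<lambda>i. \<Sum>k\<le>i. q (n + k) $ j $ (i - k)))" for n
  have step: "r n = q n + var_x * r (Suc n)" for n
  proof (rule fps2_eqI)
    fix i j
    show "r n $ j $ i = (q n + var_x * r (Suc n)) $ j $ i"
      by (cases i) (simp_all add: r_def var_x_mult_nth sum.atMost_Suc_shift del: sum.atMost_Suc)
  qed
  have "r 0 = (\<Sum>k<n. q k * var_x ^ k) + var_x ^ n * r n" for n
  proof (induction n)
    case (Suc n)
    have "var_x ^ n * r n = q n * var_x ^ n + var_x ^ Suc n * r (Suc n)"
      by (subst step) (simp add: algebra_simps)
    thus ?case using Suc by (simp add: algebra_simps)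
  qed simp
  thus thesis by (rule that)
qed

lemma x_adic_eq_0:
  fixes F :: "'k::comm_ring_1 fps2"
  assumes "\<And>n. var_x ^ n dvd F"
  shows "F = 0"
proof (rule fps2_eqI)
  fix i j
  obtain G where "F = var_x ^ Suc i * G" using assms[of "Suc i"] by (elim dvdE)
  thus "F $ j $ i = 0 $ j $ i" by (simp only: var_x_power_mult_nth) simp
qed

section \<open>Parametrisation of plane branches\<close>

text \<open>A nonconstant arc through the origin. Its target k[[t]] is embedded by
  \<open>fps_const\<close> as the series in x alone, so that the facts on \<open>alg_hom\<close>
  apply to it.\<close>

definition branch_hom :: "('k::field fps2 \<Rightarrow> 'k fps) \<Rightarrow> bool" where
  "branch_hom \<phi> \<longleftrightarrow> alg_hom (\<lambda>F. fps_const (\<phi> F)) \<and> \<phi> var_x $ 0 = 0 \<and> \<phi> var_y $ 0 = 0 \<and>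
     (\<phi> var_x \<noteq> 0 \<or> \<phi> var_y \<noteq> 0)"

lemma branch_hom_simps:
  assumes "branch_hom \<phi>"
  shows "\<phi> (F + G) = \<phi> F + \<phi> G" "\<phi> (F * G) = \<phi> F * \<phi> G" "\<phi> (cst c) = fps_const c"
    "\<phi> 0 = 0" "\<phi> 1 = 1" "\<phi> (F - G) = \<phi> F - \<phi> G" "\<phi> (F ^ n) = \<phi> F ^ n"
proof -
  have h: "alg_hom (\<lambda>F. fps_const (\<phi> F))" using assms by (simp add: branch_hom_def)
  have inj: "fps_const a = fps_const b \<Longrightarrow> a = b" for a b :: "'a fps" by simp
  show "\<phi> (F + G) = \<phi> F + \<phi> G" "\<phi> (F * G) = \<phi> F * \<phi> G" "\<phi> (F - G) = \<phi> F - \<phi> G"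
    "\<phi> (F ^ n) = \<phi> F ^ n" "\<phi> 0 = 0" "\<phi> 1 = 1" "\<phi> (cst c) = fps_const c"
    by (rule inj, simp add: alg_hom_simps[OF h] fps_const_power; simp add: cst_def)+
qed

lemma branch_hom_swap: "branch_hom \<phi> \<Longrightarrow> branch_hom (\<lambda>F. \<phi> (swap_xy F))"
  unfolding branch_hom_def using alg_hom_comp[OF _ swap_xy(1)] by (auto simp: swap_xy)

lemma decomp_mod_x:
  fixes F :: "'k::comm_ring_1 fps2"
  assumes "F $ j $ 0 \<noteq> 0"
  obtains r U R where "F = var_y ^ r * U + var_x * R" "U $ 0 $ 0 \<noteq> 0"
proof
  define r where "r = (LEAST j. F $ j $ 0 \<noteq> 0)"
  define U where "U = Abs_fps (\<lambda>j. fps_const (F $ (j + r) $ 0))"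
  define R where "R = Abs_fps (\<lambda>j. fps_shift 1 (F $ j))"
  have r: "F $ r $ 0 \<noteq> 0" "\<And>i. i < r \<Longrightarrow> F $ i $ 0 = 0"
    unfolding r_def using LeastI[of "\<lambda>j. F $ j $ 0 \<noteq> 0", OF assms] not_less_Least by blast+
  show "U $ 0 $ 0 \<noteq> 0" using r by (simp add: U_def)
  show "F = var_y ^ r * U + var_x * R"
    by (rule fps2_eqI) (auto simp: var_y_power_mult_nth var_x_mult_nth U_def R_def r(2))
qed

text \<open>An arc inside the line x = 0 sees only F(0, y), which is a power of y times a unit, and
  the image of y is nonzero. The second half is the mirror image.\<close>

lemma branch_hom_nonzero:
  assumes "branch_hom \<phi>"
  shows "\<phi> var_x = 0 \<Longrightarrow> F $ j $ 0 \<noteq> 0 \<Longrightarrow> \<phi> F \<noteq> 0"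
    and "\<phi> var_y = 0 \<Longrightarrow> F $ 0 $ i \<noteq> 0 \<Longrightarrow> \<phi> F \<noteq> 0"
proof -
  have *: "\<phi> F \<noteq> 0" if "branch_hom \<phi>" "\<phi> var_x = 0" "F $ j $ 0 \<noteq> 0" for \<phi> and F :: "'a fps2" and j
  proof -
    obtain r U R where F: "F = var_y ^ r * U + var_x * R" "U $ 0 $ 0 \<noteq> 0"
      using decomp_mod_x[OF \<open>F $ j $ 0 \<noteq> 0\<close>] .
    from F(2) obtain V where "1 = U * V" by (auto simp: unit_fps2_iff[symmetric])
    hence "\<phi> U * \<phi> V = 1" using branch_hom_simps[OF \<open>branch_hom \<phi>\<close>] by metis
    moreover have "\<phi> var_y \<noteq> 0" using that by (auto simp: branch_hom_def)
    ultimately show ?thesis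
      using that(2) by (auto simp: F branch_hom_simps[OF \<open>branch_hom \<phi>\<close>])
  qed
  show "\<phi> var_x = 0 \<Longrightarrow> F $ j $ 0 \<noteq> 0 \<Longrightarrow> \<phi> F \<noteq> 0" using * assms by blast
  show "\<phi> F \<noteq> 0" if "\<phi> var_y = 0" "F $ 0 $ i \<noteq> 0"
    using *[OF branch_hom_swap[OF assms], of "swap_xy F" i] that
    by (simp add: swap_xy) (simp add: swap_xy_def)
qed

section \<open>Tangents and blow-ups\<close>

text \<open>The part of F of degree n, dehomogenised at x = 1. For F of order n its roots are the
  slopes of the tangents other than x = 0.\<close>

definition tangent_poly :: "nat \<Rightarrow> 'k::comm_ring_1 fps2 \<Rightarrow> 'k poly" where
  "tangent_poly n F = (\<Sum>j\<le>n. monom (F $ j $ (n - j)) j)"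

lemma coeff_tangent_poly: "coeff (tangent_poly n F) j = (if j \<le> n then F $ j $ (n - j) else 0)"
proof -
  have "coeff (tangent_poly n F) j = (\<Sum>i\<le>n. if i = j then F $ i $ (n - i) else 0)"
    unfolding tangent_poly_def coeff_sum by (intro sum.cong) auto
  thus ?thesis by simp
qed

text \<open>A chart of the blow-up of the origin, recentred at the point of slope c on the
  exceptional line x = 0.\<close>

definition blow :: "'k::comm_ring_1 \<Rightarrow> 'k fps2 \<Rightarrow> 'k fps2" where
  "blow c = subst_y (var_x * (var_y + cst c))"

lemma blow: "alg_hom (blow c)" "blow c var_x = var_x" "blow c var_y = var_x * (var_y + cst c)"
proof -
  have "var_x * (var_y + cst c) \<in> ord_ge 1"
    by (intro wt_ge_mult_right wt_ge_var)
  from subst_y[OF this] show "alg_hom (blow c)" "blow c var_x = var_x" "blow c var_y = var_x * (var_y + cst c)"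
    by (simp_all add: blow_def)
qed

text \<open>The second conclusion describes G on the exceptional line. It makes G vanish at the
  origin when c is a root of the tangent polynomial, and it bounds the order of G by the degree of
  that polynomial.\<close>

lemma blow_ord_ge:
  assumes "F \<in> ord_ge n"
  obtains G where "blow c F = var_x ^ n * G"
    "\<And>j. G $ j $ 0 = coeff (pcompose (tangent_poly n F) [:c, 1:]) j"
proof -
  note s = alg_hom_simps[OF blow(1)[of c]] blow(2,3)[of c]
  have "\<exists>G. blow c F = var_x ^ n * G \<and>
      (\<forall>j. G $ j $ 0 = coeff (pcompose (tangent_poly n F) [:c, 1:]) j)"
    using assms
  proof (induction n arbitrary: F)
    case 0
    have t: "tangent_poly 0 F = [:F $ 0 $ 0:]" by (simp add: tangent_poly_def monom_0)
    have "blow c F = cst (F $ 0 $ 0) + var_x * (blow c (low_x F) + (var_y + cst c) * blow c (low_y F))"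
      by (subst low_decomp) (simp add: s algebra_simps)
    hence "blow c F $ j $ 0 = coeff (pcompose (tangent_poly 0 F) [:c, 1:]) j" for j
      by (simp only: fps_add_nth var_x_mult_nth cst_nth t pcompose_const) (cases j; simp)
    thus ?case by auto
  next
    case (Suc n)
    define A where "A = low_x F"
    define B where "B = low_y F"
    have AB: "A \<in> ord_ge n" "B \<in> ord_ge n"
      using wt_ge_low[OF Suc.prems] by (simp_all add: A_def B_def)
    have F: "F = var_x * A + var_y * B"
      using low_decomp[of F] wt_geD[OF Suc.prems, of 0 0] by (simp add: A_def B_def cst_simps)
    have t: "tangent_poly (Suc n) F = tangent_poly n A + [:0, 1:] * tangent_poly n B"
      by (rule poly_eqI)
         (auto simp: coeff_tangent_poly coeff_pCons A_def B_def low_x_def low_y_def split: nat.splits)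
    obtain A' where A': "blow c A = var_x ^ n * A'"
        "\<And>j. A' $ j $ 0 = coeff (pcompose (tangent_poly n A) [:c, 1:]) j"
      using Suc.IH[OF AB(1)] by blast
    obtain B' where B': "blow c B = var_x ^ n * B'"
        "\<And>j. B' $ j $ 0 = coeff (pcompose (tangent_poly n B) [:c, 1:]) j"
      using Suc.IH[OF AB(2)] by blast
    have "blow c F = var_x ^ Suc n * (A' + (var_y * B' + cst c * B'))"
      by (simp add: F s A' B' algebra_simps)
    moreover have "(A' + (var_y * B' + cst c * B')) $ j $ 0 =
        coeff (pcompose (tangent_poly (Suc n) F) [:c, 1:]) j" for j
      unfolding t
      by (simp only: fps_add_nth var_y_mult_nth cst_mult_nth A' B')
         (simp add: pcompose_add pcompose_mult pcompose_pCons coeff_pCons split: nat.splits)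
    ultimately show ?case by blast
  qed
  thus thesis using that by blast
qed

definition has_branch :: "'k::field fps2 \<Rightarrow> bool" where
  "has_branch F \<longleftrightarrow> (\<exists>\<phi>. branch_hom \<phi> \<and> \<phi> F = 0)"

text \<open>An arc of the transform G is pushed down along the blow-up. Inside the exceptional line
  it would be contracted to the origin; the nonzero coefficient of G excludes this.\<close>

lemma has_branch_blow:
  assumes "has_branch G" "blow c F = var_x ^ n * G" "G $ j $ 0 \<noteq> 0"
  shows "has_branch F"
proof -
  note b = blow(2,3)[of c]
  obtain \<phi> where \<phi>: "branch_hom \<phi>" "\<phi> G = 0" using assms(1) by (auto simp: has_branch_def)
  note s = branch_hom_simps[OF \<phi>(1)]
  have "\<phi> var_x \<noteq> 0" using branch_hom_nonzero(1)[OF \<phi>(1) _ assms(3)] \<phi>(2) by blast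
  moreover have "\<phi> var_x $ 0 = 0" using \<phi>(1) by (simp add: branch_hom_def)
  moreover have "alg_hom (\<lambda>F. fps_const (\<phi> (blow c F)))"
    using \<phi>(1) alg_hom_comp[OF _ blow(1)[of c], of "\<lambda>F. fps_const (\<phi> F)"] by (simp add: branch_hom_def)
  ultimately have "branch_hom (\<lambda>F. \<phi> (blow c F))"
    by (simp add: branch_hom_def b s)
  moreover have "\<phi> (blow c F) = 0" by (simp add: assms(2) s \<phi>)
  ultimately show ?thesis by (auto simp: has_branch_def)
qed

lemma ord_ge_exact:
  assumes "F \<noteq> 0"
  obtains n where "F \<in> ord_ge n" "F \<notin> ord_ge (Suc n)"
proof -
  from assms obtain k where "F \<notin> ord_ge k" using ord_ge_eq_0 by blast
  define m where "m = (LEAST k. F \<notin> ord_ge k)"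
  have m: "F \<notin> ord_ge m" using \<open>F \<notin> ord_ge k\<close> unfolding m_def by (rule LeastI)
  then obtain n where n: "m = Suc n" by (cases m) auto
  have "F \<in> ord_ge n" using not_less_Least[of n "\<lambda>k. F \<notin> ord_ge k"] n by (auto simp: m_def)
  thus thesis using that m n by blast
qed

text \<open>After blowing up at a root c, the order of the transform is positive and at most the
  degree of the tangent polynomial, hence at most n. If it is less than n, induction gives a branch;
  if it equals n, then y^n occurs in the transform, which is the condition for going on.\<close>

lemma tangent_root:
  fixes F :: "'k::alg_closed_field fps2"
  assumes F: "F \<in> ord_ge n" and deg: "degree (tangent_poly n F) > 0"
    and IH: "\<And>m G. 0 < m \<Longrightarrow> m < n \<Longrightarrow> G \<in> ord_ge m \<Longrightarrow> G \<notin> ord_ge (Suc m) \<Longrightarrow>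
       has_branch (G :: 'k fps2)"
  shows "has_branch F \<or> (\<exists>c G. blow c F = var_x ^ n * G \<and> G \<in> ord_ge n \<and> G $ n $ 0 \<noteq> 0)"
proof -
  let ?t = "tangent_poly n F"
  obtain c where c: "poly ?t c = 0" using alg_closed_imp_poly_has_root[OF deg] by blast
  define h where "h = pcompose ?t [:c, 1:]"
  have degh: "degree h = degree ?t" by (simp add: h_def degree_pcompose)
  have degt: "degree ?t \<le> n" by (rule degree_le) (simp add: coeff_tangent_poly)
  obtain G where G: "blow c F = var_x ^ n * G" "\<And>j. G $ j $ 0 = coeff h j"
    using blow_ord_ge[OF F, of c] unfolding h_def by blast
  have G0: "G $ 0 $ 0 = 0"
    using c by (simp add: G(2) h_def coeff_pcompose_0)
  have "h \<noteq> 0" using deg degh by auto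
  hence Gd: "G $ degree h $ 0 \<noteq> 0" by (simp add: G(2))
  hence "G \<noteq> 0" by auto
  then obtain m where m: "G \<in> ord_ge m" "G \<notin> ord_ge (Suc m)" by (rule ord_ge_exact)
  have "m \<noteq> 0"
  proof
    assume "m = 0"
    thus False using m G0 by (auto simp: wt_ge_def)
  qed
  have mn: "m \<le> degree h"
    using wt_geD[OF m(1), of 0 "degree h"] Gd by (cases "m \<le> degree h") auto
  show ?thesis
  proof (cases "m < n")
    case True
    with IH[OF _ _ m] \<open>m \<noteq> 0\<close> have "has_branch G" by simp
    from has_branch_blow[OF this G(1) Gd] show ?thesis ..
  next
    case False
    hence "m = n" "degree h = n" using mn degt degh by simp_all
    thus ?thesis using G(1) m Gd by blast
  qed
qed

text \<open>The centres are the coefficients of the arc y = c_0 x + c_1 x^2 + ...: each blow-up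
  shows that F is divisible by a further x^n along it.\<close>

lemma has_branch_of_tangent_chain:
  fixes F :: "nat \<Rightarrow> 'k::field fps2"
  assumes n: "n > 0" and chain: "\<And>k. blow (c k) (F k) = var_x ^ n * F (Suc k)"
  shows "has_branch (F 0)"
proof -
  \<comment> \<open>\<open>\<psi> k\<close> is the arc as seen after k blow-ups; its recursion is
    the chart map of the next one.\<close>
  define \<psi> where "\<psi> k = Abs_fps (\<lambda>l. if l = 0 then 0 else c (k + l - 1))" for k
  have \<psi>_Suc: "\<psi> k = fps_X * (fps_const (c k) + \<psi> (Suc k))" for k
    by (rule fps_ext) (auto simp: \<psi>_def le_Suc_eq)
  define ev where "ev k = subst_y (fps_const (\<psi> k))" for k
  have \<psi>1: "fps_const (\<psi> k) \<in> ord_ge 1" for k by (auto simp: wt_ge_def \<psi>_def)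
  note ev = subst_y[OF \<psi>1, folded ev_def]
  have step: "ev k G = ev (Suc k) (blow (c k) G)" for k G
  proof (rule alg_hom_unique[OF ev(1) alg_hom_comp[OF ev(1) blow(1)]])
    show "ev k var_x = ev (Suc k) (blow (c k) var_x)" by (simp add: ev blow)
    have "ev (Suc k) (blow (c k) var_y) = var_x * (fps_const (\<psi> (Suc k)) + cst (c k))"
      by (simp add: ev blow alg_hom_simps[OF ev(1)])
    also have "\<dots> = fps_const (\<psi> k)"
      by (subst \<psi>_Suc) (simp add: var_x_def cst_def add.commute)
    finally show "ev k var_y = ev (Suc k) (blow (c k) var_y)" by (simp add: ev)
    show "ev k var_x \<in> ord_ge 1" "ev k var_y \<in> ord_ge 1" using \<psi>1 by (simp_all add: ev wt_ge_var)
  qed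
  have "ev 0 (F 0) = var_x ^ (n * k) * ev k (F k)" for k
  proof (induction k)
    case (Suc k)
    have "ev k (F k) = var_x ^ n * ev (Suc k) (F (Suc k))"
      by (subst step) (simp add: chain alg_hom_simps[OF ev(1)] ev(2))
    thus ?case by (simp add: Suc power_add algebra_simps)
  qed simp
  moreover have "var_x ^ k dvd (var_x ^ (n * k) :: 'k fps2)" for k
    using n by (intro le_imp_power_dvd) simp
  ultimately have "var_x ^ k dvd ev 0 (F 0)" for k
    by (metis dvd_mult2)
  hence z: "ev 0 (F 0) = 0" by (rule x_adic_eq_0)
  have "branch_hom (\<lambda>F. ev 0 F $ 0)"
    unfolding branch_hom_def
    by (auto simp: alg_hom_def alg_hom_simps[OF ev(1)] ev) (simp_all add: cst_def var_x_def \<psi>_def)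
  thus ?thesis using z unfolding has_branch_def by (intro exI[of _ "\<lambda>F. ev 0 F $ 0"]) simp
qed

theorem has_branch:
  fixes F :: "'k::alg_closed_field fps2"
  assumes "F \<in> ord_ge n" "F \<notin> ord_ge (Suc n)" "n > 0"
  shows "has_branch F"
  using assms
proof (induction n arbitrary: F rule: less_induct)
  case (less n)
  have IH: "has_branch G" if "0 < m" "m < n" "G \<in> ord_ge m" "G \<notin> ord_ge (Suc m)" for m and G :: "'k fps2"
    using less.IH[of m G] that by simp
  \<comment> \<open>If y^n occurs, the tangent polynomial has degree n > 0. Without a branch on F
    none of the transforms has one either, so the order stays n forever; the resulting infinite
    chain of blow-ups yields a branch after all.\<close>
  have A: "has_branch F" if F: "F \<in> ord_ge n" "F $ n $ 0 \<noteq> 0" for F :: "'k fps2"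
  proof (rule ccontr)
    define P where "P = (\<lambda>F :: 'k fps2. F \<in> ord_ge n \<and> F $ n $ 0 \<noteq> 0 \<and> \<not> has_branch F)"
    assume "\<not> has_branch F"
    hence PF: "P F" using F by (simp add: P_def)
    have "\<exists>G. P G \<and> (\<exists>c. blow c F = var_x ^ n * G)" if "P F" for F
    proof -
      have F: "F \<in> ord_ge n" "F $ n $ 0 \<noteq> 0" "\<not> has_branch F" using that by (auto simp: P_def)
      have "coeff (tangent_poly n F) n \<noteq> 0" using F by (simp add: coeff_tangent_poly)
      from le_degree[OF this] have "degree (tangent_poly n F) > 0" using \<open>n > 0\<close> by simp
      have "has_branch F \<or> (\<exists>c G. blow c F = var_x ^ n * G \<and> G \<in> ord_ge n \<and> G $ n $ 0 \<noteq> 0)"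
        by (rule tangent_root) (fact F(1), fact, rule IH)
      with F(3) obtain c G where
        G: "blow c F = var_x ^ n * G" "G \<in> ord_ge n" "G $ n $ 0 \<noteq> 0" by blast
      have "\<not> has_branch G" using has_branch_blow[OF _ G(1) G(3)] F(3) by blast
      thus ?thesis using G by (auto simp: P_def)
    qed
    then obtain nxt where nxt: "\<And>F. P F \<Longrightarrow> P (nxt F) \<and> (\<exists>c. blow c F = var_x ^ n * nxt F)"
      by metis
    define S where "S k = (nxt ^^ k) F" for k
    have PS: "P (S k)" for k by (induction k) (use PF nxt in \<open>auto simp: S_def\<close>)
    have "\<exists>c. blow c (S k) = var_x ^ n * S (Suc k)" for k
      using nxt[OF PS[of k]] by (simp add: S_def)
    then obtain c where "\<And>k. blow (c k) (S k) = var_x ^ n * S (Suc k)" by metis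
    with \<open>n > 0\<close> have "has_branch (S 0)" by (rule has_branch_of_tangent_chain)
    with PS[of 0] show False by (simp add: P_def)
  qed
  show ?case
  proof (cases "degree (tangent_poly n F) > 0")
    case True
    have "has_branch F \<or> (\<exists>c G. blow c F = var_x ^ n * G \<and> G \<in> ord_ge n \<and> G $ n $ 0 \<noteq> 0)"
      by (rule tangent_root) (fact less.prems(1), fact True, rule IH)
    thus ?thesis using has_branch_blow[OF A] by blast
  next
    case False
    text \<open>The initial form is then a multiple of $x^n$.\<close>
    have "\<exists>i j. i + j < Suc n \<and> F $ j $ i \<noteq> 0" using less.prems(2) by (auto simp: wt_ge_def)
    then obtain i j where ij: "i + j < Suc n" "F $ j $ i \<noteq> 0" by blast
    have "\<not> i + j < n" using ij wt_geD[OF less.prems(1), of i j] by auto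
    hence "i + j = n" using ij by simp
    hence "coeff (tangent_poly n F) j \<noteq> 0" using ij by (auto simp: coeff_tangent_poly)
    from le_degree[OF this] have "j = 0" using False by simp
    hence "swap_xy F $ n $ 0 \<noteq> 0" using ij \<open>i + j = n\<close> by (simp add: swap_xy_def)
    moreover have "swap_xy F \<in> ord_ge n"
      using less.prems(1) by (auto simp: wt_ge_def swap_xy_def add.commute)
    ultimately have "has_branch (swap_xy F)" by (intro A)
    then obtain \<phi> where "branch_hom \<phi>" "\<phi> (swap_xy F) = 0" by (auto simp: has_branch_def)
    with branch_hom_swap[of \<phi>] show ?thesis by (auto simp: has_branch_def)
  qed
qed

section \<open>The kernel of a branch\<close>

definition slice :: "'k::comm_ring_1 fps2 \<Rightarrow> 'k fps" where
  "slice F = Abs_fps (\<lambda>j. F $ j $ 0)"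

lemma slice_mult: "slice (F * G) = slice F * slice G"
  by (rule fps_ext) (simp add: slice_def fps_mult_nth fps_sum_nth)

lemma slice_diff: "slice (F - G) = slice F - slice G"
  by (rule fps_ext) (simp add: slice_def)

lemma slice_eq_0:
  fixes F :: "'k::comm_ring_1 fps2"
  assumes "slice F = 0"
  obtains G where "F = var_x * G"
proof
  have "F $ j $ 0 = 0" for j using assms by (simp add: slice_def fps_eq_iff)
  thus "F = var_x * Abs_fps (\<lambda>j. fps_shift 1 (F $ j))"
    by (intro fps2_eqI) (simp add: var_x_mult_nth)
qed

text \<open>The kernel is principal. Its element \<open>f0\<close> whose restriction to x = 0 has
  least order divides any other one modulo x, and the quotient of the difference by x stays in the
  kernel because \<open>\<phi> var_x\<close> is nonzero. Repeating this gives divisibility by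
  \<open>f0\<close>. As f is irreducible, f and \<open>f0\<close> are associated.\<close>

lemma branch_hom_kernel:
  fixes f :: "'k::field fps2"
  assumes "irreducible f" and f2: "f \<in> ord_ge 2" and \<phi>: "branch_hom \<phi>" and "\<phi> f = 0"
  shows "\<phi> var_x \<noteq> 0" and "\<phi> g = 0 \<longleftrightarrow> f dvd g"
proof -
  note s = branch_hom_simps[OF \<phi>]
  \<comment> \<open>Otherwise f would be x times a unit and have a linear term.\<close>
  have ndvd: "\<not> var_x dvd f"
  proof
    assume "var_x dvd f"
    then obtain h where h: "f = var_x * h" by (elim dvdE)
    have "\<not> var_x dvd (1 :: 'k fps2)" by (simp add: unit_fps2_iff var_x_nth)
    with irreducibleD[OF assms(1) h] have "h dvd 1" by blast
    hence "f $ 0 $ 1 \<noteq> 0" by (simp add: h var_x_mult_nth unit_fps2_iff del: fps_mult_nth_0)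
    thus False using wt_geD[OF f2, of 1 0] by simp
  qed
  hence slf: "slice f \<noteq> 0" by (metis slice_eq_0 dvd_triv_left)
  show x: "\<phi> var_x \<noteq> 0"
  proof
    assume x0: "\<phi> var_x = 0"
    from slf obtain j where "f $ j $ 0 \<noteq> 0" by (auto simp: slice_def fps_eq_iff)
    from branch_hom_nonzero(1)[OF \<phi> x0 this] assms(4) show False by simp
  qed
  obtain f0 where f0: "\<phi> f0 = 0" "slice f0 \<noteq> 0"
      "\<And>h. \<phi> h = 0 \<Longrightarrow> slice h \<noteq> 0 \<Longrightarrow> subdegree (slice f0) \<le> subdegree (slice h)"
    using slf assms(4)
      ex_has_least_nat[of "\<lambda>h. \<phi> h = 0 \<and> slice h \<noteq> 0" f "\<lambda>h. subdegree (slice h)"] by blast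
  have "\<exists>q h'. h = q * f0 + var_x * h' \<and> \<phi> h' = 0" if "\<phi> h = 0" for h
  proof -
    have "slice f0 dvd slice h"
      using f0 that by (cases "slice h = 0") (auto simp: fps_dvd_iff)
    then obtain q where q: "slice h = slice f0 * q" by (elim dvdE)
    define Q where "Q = Abs_fps (\<lambda>j. fps_const (q $ j))"
    have "slice Q = q" by (simp add: slice_def Q_def fps_eq_iff)
    hence "slice (h - Q * f0) = 0" by (simp add: slice_diff slice_mult q)
    then obtain h' where h': "h - Q * f0 = var_x * h'" by (rule slice_eq_0)
    have "\<phi> (h - Q * f0) = 0" by (simp add: s that f0)
    hence "\<phi> h' = 0" using x by (simp add: h' s)
    moreover have "h = Q * f0 + var_x * h'" using h' by (simp add: algebra_simps)
    ultimately show ?thesis by blast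
  qed
  then obtain quo nxt where step: "\<And>h. \<phi> h = 0 \<Longrightarrow> h = quo h * f0 + var_x * nxt h \<and> \<phi> (nxt h) = 0"
    by metis
  have dvd: "f0 dvd g" if "\<phi> g = 0" for g
  proof -
    define G where "G n = (nxt ^^ n) g" for n
    have G: "\<phi> (G n) = 0" for n by (induction n) (use that step in \<open>auto simp: G_def\<close>)
    have gn: "g = (\<Sum>k<n. quo (G k) * var_x ^ k) * f0 + var_x ^ n * G n" for n
    proof (induction n)
      case (Suc n)
      have "G n = quo (G n) * f0 + var_x * G (Suc n)" using step[OF G] by (simp add: G_def)
      hence "var_x ^ n * G n = var_x ^ n * (quo (G n) * f0 + var_x * G (Suc n))" by (rule arg_cong)
      with Suc show ?case by (simp add: algebra_simps)
    qed (simp add: G_def)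
    obtain S r where S: "\<And>n. S = (\<Sum>k<n. quo (G k) * var_x ^ k) + var_x ^ n * r n"
      using x_adic_limit[of "\<lambda>k. quo (G k)"] by blast
    have "var_x ^ n dvd g - S * f0" for n
    proof -
      have "g - S * f0 = var_x ^ n * (G n - r n * f0)"
        by (subst gn[of n], subst S[of n]) (simp add: algebra_simps)
      thus ?thesis by simp
    qed
    hence "g - S * f0 = 0" by (rule x_adic_eq_0)
    thus ?thesis by simp
  qed
  have "\<not> f0 dvd 1"
  proof
    assume "f0 dvd 1"
    then obtain v where "1 = f0 * v" by (elim dvdE)
    hence "\<phi> 1 = \<phi> f0 * \<phi> v" by (metis s(2))
    thus False using f0 s by simp
  qed
  moreover from dvd[OF assms(4)] obtain u where u: "f = f0 * u" by (elim dvdE)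
  ultimately have "u dvd 1" using irreducibleD[OF assms(1) u] by blast
  hence "f dvd f0" unfolding u by (metis mult_dvd_mono dvd_refl mult.right_neutral)
  thus "\<phi> g = 0 \<longleftrightarrow> f dvd g"
    using dvd[of g] dvd_trans assms(4) by (auto simp: s elim!: dvdE)
qed

section \<open>The value filtration\<close>

text \<open>d is taken as the least positive difference of two elements. Then S contains some t = dM
  and t + d, and these generate all dk with k \<ge> M^2: if r is the remainder of k by M, then r is
  at most the quotient, so k = cM + r(M + 1).\<close>

lemma nat_semigroup_period:
  fixes S :: "nat set"
  assumes 0: "0 \<in> S" and add: "\<And>a b. a \<in> S \<Longrightarrow> b \<in> S \<Longrightarrow> a + b \<in> S" and n: "n \<in> S" "n > 0"
  obtains d C where "d > 0" "\<And>s. s \<in> S \<Longrightarrow> d dvd s" "\<And>k. k \<ge> C \<Longrightarrow> d * k \<in> S"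
proof -
  have mult: "q * a \<in> S" if "a \<in> S" for q a
    by (induction q) (use that 0 add in auto)
  define D where "D = (\<lambda>e. e > 0 \<and> (\<exists>s\<in>S. s + e \<in> S))"
  define d where "d = (LEAST e. D e)"
  have "D n" using 0 n unfolding D_def by force
  hence "D d" unfolding d_def by (rule LeastI)
  then obtain s where d: "d > 0" "s \<in> S" "s + d \<in> S" by (auto simp: D_def)
  have dvd: "d dvd a" if "a \<in> S" for a
  proof (rule ccontr)
    assume "\<not> d dvd a"
    hence "a mod d > 0" by (simp add: mod_greater_zero_iff_not_dvd)
    moreover have "a div d * (s + d) + a mod d = a + a div d * s"
      by (simp add: algebra_simps)
    moreover have "a + a div d * s \<in> S" "a div d * (s + d) \<in> S" using add mult d that by auto
    ultimately have "D (a mod d)" unfolding D_def by (auto intro!: bexI[of _ "a div d * (s + d)"])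
    moreover have "a mod d < d" using d by simp
    ultimately show False using not_less_Least[of "a mod d" D] by (simp add: d_def)
  qed
  \<comment> \<open>Adding n makes the smaller element positive, which s need not be.\<close>
  define t where "t = s + n"
  have t: "t \<in> S" "t + d \<in> S" "t > 0"
    using add[OF d(2) n(1)] add[OF d(3) n(1)] n by (simp_all add: t_def algebra_simps)
  from dvd[OF t(1)] obtain M where M: "t = d * M" by (elim dvdE)
  have "M > 0" using t M by auto
  have "d * k \<in> S" if "k \<ge> M * M" for k
  proof -
    have "M \<le> k div M" using that \<open>M > 0\<close> by (simp add: less_eq_div_iff_mult_less_eq)
    moreover have "k mod M < M" using \<open>M > 0\<close> by simp
    ultimately have "k mod M \<le> k div M" by linarith
    then obtain c where c: "k div M = k mod M + c" by (auto simp: le_iff_add)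
    define r where "r = k mod M"
    have "k = (r + c) * M + r" using c div_mult_mod_eq[of k M] by (simp add: r_def)
    hence "d * k = c * t + r * (t + d)" unfolding M by (simp add: algebra_simps)
    thus ?thesis using add mult t by simp
  qed
  thus thesis using that d(1) dvd by blast
qed

text \<open>$V_n$ stands for the set of all $g$ with $i(f,g) \ge n$.\<close>

locale branch_filtration =
  fixes f :: "'k::field fps2" and V :: "nat \<Rightarrow> 'k fps2 set"
  assumes f_ord: "f \<in> ord_ge 2"
    and V_0: "g \<in> V 0"
    and V_Suc: "V (Suc n) \<subseteq> V n"
    and V_add: "g \<in> V n \<Longrightarrow> h \<in> V n \<Longrightarrow> g + h \<in> V n"
    and V_mult: "g \<in> V n \<Longrightarrow> h \<in> V m \<Longrightarrow> g * h \<in> V (n + m)"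
    and V_mult_exact: "g \<in> V n - V (Suc n) \<Longrightarrow> h \<in> V m - V (Suc m) \<Longrightarrow> g * h \<notin> V (Suc (n + m))"
    and V_lead: "g \<in> V n \<Longrightarrow> h \<in> V n - V (Suc n) \<Longrightarrow> \<exists>c. g - cst c * h \<in> V (Suc n)"
    and V_Inter: "(\<forall>n. g \<in> V n) \<longleftrightarrow> f dvd g"
    and V_cofinite: "\<exists>C. \<forall>n\<ge>C. \<exists>g. g \<in> V n - V (Suc n)"

text \<open>The arc is not shown to be primitive, so the orders along it may have a common factor.
  Dividing by their period d makes almost all integers values.\<close>

theorem branch_filtration_exists:
  fixes f :: "'k::alg_closed_field fps2"
  assumes "irreducible f" "f \<in> ord_ge 2"
  shows "\<exists>V. branch_filtration f V"
proof -
  have "f \<noteq> 0" using assms(1) by auto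
  then obtain n where n: "f \<in> ord_ge n" "f \<notin> ord_ge (Suc n)" by (rule ord_ge_exact)
  have "n > 0" using n assms(2) wt_ge_mono[of f 1 1 2 1] by (cases n) auto
  from has_branch[OF n this] obtain \<phi> where \<phi>: "branch_hom \<phi>" "\<phi> f = 0"
    by (auto simp: has_branch_def)
  note s = branch_hom_simps[OF \<phi>(1)]
  note x = branch_hom_kernel(1)[OF assms \<phi>]
  note ker = branch_hom_kernel(2)[OF assms \<phi>]
  define S where "S = {subdegree (\<phi> g) | g. \<phi> g \<noteq> 0}"
  have "0 \<in> S" unfolding S_def by (rule CollectI, rule exI[of _ 1]) (simp add: s)
  moreover have "a + b \<in> S" if "a \<in> S" "b \<in> S" for a b
  proof -
    from that obtain g h where "a = subdegree (\<phi> g)" "\<phi> g \<noteq> 0" "b = subdegree (\<phi> h)" "\<phi> h \<noteq> 0"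
      by (auto simp: S_def)
    hence "a + b = subdegree (\<phi> (g * h))" "\<phi> (g * h) \<noteq> 0" by (simp_all add: s)
    thus ?thesis by (auto simp: S_def)
  qed
  moreover have "subdegree (\<phi> var_x) \<in> S" using x by (auto simp: S_def)
  moreover have "subdegree (\<phi> var_x) > 0"
  proof (rule gr0I)
    assume "subdegree (\<phi> var_x) = 0"
    with x \<phi>(1) nth_subdegree_nonzero[of "\<phi> var_x"] show False by (simp add: branch_hom_def)
  qed
  ultimately obtain d C where d: "d > 0" "\<And>s. s \<in> S \<Longrightarrow> d dvd s" "\<And>k. k \<ge> C \<Longrightarrow> d * k \<in> S"
    by (rule nat_semigroup_period) blast+
  define V where "V n = {g. \<phi> g = 0 \<or> d * n \<le> subdegree (\<phi> g)}" for n
  have V_iff: "g \<in> V n \<longleftrightarrow> (\<forall>i<d * n. \<phi> g $ i = 0)" for g n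
  proof (cases "\<phi> g = 0")
    case False
    hence "(d * n \<le> subdegree (\<phi> g)) = (\<forall>i<d * n. \<phi> g $ i = 0)"
      by (metis less_le_trans nth_less_subdegree_zero subdegree_geI)
    thus ?thesis using False by (simp add: V_def)
  qed (simp add: V_def)
  \<comment> \<open>Orders are multiples of d, so to exceed \<open>d * n\<close> is to reach
    \<open>d * Suc n\<close>.\<close>
  have V_sd: "g \<in> V (Suc n) \<longleftrightarrow> \<phi> g = 0 \<or> d * n < subdegree (\<phi> g)" for g n
  proof (cases "\<phi> g = 0")
    case False
    hence "d dvd subdegree (\<phi> g)" by (intro d(2)) (auto simp: S_def)
    then obtain m where m: "subdegree (\<phi> g) = d * m" by (elim dvdE)
    thus ?thesis using d(1) False by (simp add: V_def m Suc_le_eq del: mult_Suc_right)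
  qed (simp add: V_def)
  have V_sd': "g \<in> V n - V (Suc n) \<longleftrightarrow> \<phi> g \<noteq> 0 \<and> subdegree (\<phi> g) = d * n" for g n
    using V_sd[of g n] by (auto simp: V_def)
  have "branch_filtration f V"
  proof
    fix g h n m
    show "g \<in> V 0" "V (Suc n) \<subseteq> V n" unfolding V_def by auto
    show "g \<in> V n \<Longrightarrow> h \<in> V n \<Longrightarrow> g + h \<in> V n" by (simp add: V_iff s)
    show "g \<in> V n \<Longrightarrow> h \<in> V m \<Longrightarrow> g * h \<in> V (n + m)"
      by (cases "\<phi> g = 0 \<or> \<phi> h = 0") (auto simp: V_def s distrib_left)
    show "g \<in> V n - V (Suc n) \<Longrightarrow> h \<in> V m - V (Suc m) \<Longrightarrow> g * h \<notin> V (Suc (n + m))"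
      unfolding V_sd' V_sd by (simp add: s distrib_left)
    show "\<exists>c. g - cst c * h \<in> V (Suc n)" if g: "g \<in> V n" and h: "h \<in> V n - V (Suc n)"
    proof
      define c where "c = \<phi> g $ (d * n) / \<phi> h $ (d * n)"
      have h': "\<phi> h \<noteq> 0" "subdegree (\<phi> h) = d * n" using h V_sd' by auto
      hence "\<phi> h $ (d * n) \<noteq> 0" by (metis nth_subdegree_nonzero)
      hence c: "\<phi> (g - cst c * h) $ (d * n) = 0" by (simp add: s c_def)
      have "\<phi> (g - cst c * h) $ i = 0" if "i < d * n" for i
        using that g h by (auto simp: s V_iff)
      with c have "\<phi> (g - cst c * h) $ i = 0" if "i \<le> d * n" for i
        using that by (cases "i = d * n") auto
      thus "g - cst c * h \<in> V (Suc n)"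
        unfolding V_sd by (metis linorder_not_less nth_subdegree_nonzero)
    qed
    show "(\<forall>n. g \<in> V n) \<longleftrightarrow> f dvd g"
    proof
      assume "\<forall>n. g \<in> V n"
      hence "g \<in> V (Suc (subdegree (\<phi> g)))" by blast
      hence "\<phi> g = 0 \<or> d * subdegree (\<phi> g) < 1 * subdegree (\<phi> g)" by (simp add: V_sd)
      hence "\<phi> g = 0" using d(1) by (simp only: mult_less_cancel2) simp
      thus "f dvd g" using ker by simp
    next
      assume "f dvd g"
      thus "\<forall>n. g \<in> V n" using ker[of g] by (simp add: V_def)
    qed
    show "\<exists>C. \<forall>n\<ge>C. \<exists>g. g \<in> V n - V (Suc n)"
    proof (rule exI[of _ C], intro allI impI)
      fix n assume "C \<le> n"
      from d(3)[OF this] obtain g where "\<phi> g \<noteq> 0" "subdegree (\<phi> g) = d * n"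
        unfolding S_def by auto
      thus "\<exists>g. g \<in> V n - V (Suc n)" unfolding V_sd' by blast
    qed
  qed (fact assms(2))
  thus ?thesis by blast
qed

section \<open>Linear algebra modulo a subspace, and ideals with two generators\<close>

interpretation fps2: vector_space "scalar :: 'k::field \<Rightarrow> 'k fps2 \<Rightarrow> 'k fps2"
  by unfold_locales (simp_all add: scalar_conv_cst cst_simps algebra_simps)

text \<open>Compares dimensions in the quotient by W without forming it: representatives in the span
  of B of a family independent modulo W are distinct and independent.\<close>

lemma card_le_of_independent_mod:
  fixes e :: "'i \<Rightarrow> 'k::field fps2"
  assumes W: "fps2.subspace W" and B: "finite B" "\<And>v. \<exists>u\<in>fps2.span B. v - u \<in> W"
    and T: "finite T" "\<And>c t. (\<Sum>t\<in>T. scalar (c t) (e t)) \<in> W \<Longrightarrow> t \<in> T \<Longrightarrow> c t = 0"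
  shows "card T \<le> card B"
proof -
  obtain u where u: "\<And>v. u v \<in> fps2.span B" "\<And>v. v - u v \<in> W"
    using B(2) by metis
  have diff: "v \<in> W" if "v - w \<in> W" "w \<in> W" for v w
    using fps2.subspace_add[OF W that] by simp
  have zero: "c t = 0" if "(\<Sum>t\<in>T. scalar (c t) (u (e t))) = 0" "t \<in> T" for c t
  proof -
    have "(\<Sum>t\<in>T. scalar (c t) (e t - u (e t))) \<in> W"
      by (intro fps2.subspace_sum fps2.subspace_scale W u)
    hence "(\<Sum>t\<in>T. scalar (c t) (e t)) \<in> W"
      using that(1) by (simp add: fps2.scale_right_diff_distrib sum_subtractf)
    thus ?thesis using T(2) that(2) by blast
  qed
  have inj: "inj_on (\<lambda>t. u (e t)) T"
  proof (rule inj_onI, rule ccontr)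
    fix s t assume st: "s \<in> T" "t \<in> T" "u (e s) = u (e t)" "s \<noteq> t"
    define c where "c r = (if r = s then 1 else if r = t then -1 else 0 :: 'k)" for r
    have "(\<Sum>r\<in>T. scalar (c r) (u (e r))) = (\<Sum>r\<in>{s, t}. scalar (c r) (u (e r)))"
      using st T(1) by (intro sum.mono_neutral_right) (auto simp: c_def)
    also have "\<dots> = 0" using st by (simp add: c_def)
    finally have "c s = 0" using zero st by blast
    thus False by (simp add: c_def)
  qed
  have "fps2.independent ((\<lambda>t. u (e t)) ` T)"
  proof (subst fps2.dependent_finite)
    show "\<not> (\<exists>c. (\<exists>v\<in>(\<lambda>t. u (e t)) ` T. c v \<noteq> 0) \<and> (\<Sum>v\<in>(\<lambda>t. u (e t)) ` T. scalar (c v) v) = 0)"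
    proof clarify
      fix c t assume "(\<Sum>v\<in>(\<lambda>t. u (e t)) ` T. scalar (c v) v) = 0" "t \<in> T" "c (u (e t)) \<noteq> 0"
      thus False using zero[of "\<lambda>t. c (u (e t))" t] by (simp add: sum.reindex[OF inj])
    qed
  qed (use T in simp)
  from fps2.independent_span_bound[OF B(1) this] u have "card ((\<lambda>t. u (e t)) ` T) \<le> card B" by auto
  thus ?thesis by (simp add: card_image[OF inj])
qed

lemma ideal_gen_singleton: "g \<in> ideal_gen {f} \<longleftrightarrow> f dvd g"
proof -
  have "ideal_gen {f} = {r * f + s * f | r s. True}"
    using ideal_gen_insert2[of f f] by simp
  moreover have "f dvd g \<longleftrightarrow> (\<exists>r s. g = r * f + s * f)"
  proof
    assume "f dvd g"
    then obtain r where "g = f * r" by (elim dvdE)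
    hence "g = r * f + 0 * f" by (simp add: mult.commute)
    thus "\<exists>r s. g = r * f + s * f" by blast
  qed (auto intro: dvd_add)
  ultimately show ?thesis by simp
qed

lemma ideal_gen_pair: "v \<in> ideal_gen {f, g} \<longleftrightarrow> (\<exists>h. f dvd v - g * h)"
proof
  assume "v \<in> ideal_gen {f, g}"
  then obtain r s where "v = r * f + s * g" by (auto simp: ideal_gen_insert2)
  hence "f dvd v - g * s" by simp
  thus "\<exists>h. f dvd v - g * h" ..
next
  assume "\<exists>h. f dvd v - g * h"
  then obtain h r where "v - g * h = f * r" by (auto elim!: dvdE)
  hence "v = r * f + h * g" by (simp add: algebra_simps)
  thus "v \<in> ideal_gen {f, g}" unfolding ideal_gen_insert2 by blast
qed

lemma subspace_ideal_gen_pair: "fps2.subspace (ideal_gen {f, g})"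
proof -
  interpret module "(*) :: 'a fps2 \<Rightarrow> 'a fps2 \<Rightarrow> 'a fps2"
    by unfold_locales (simp_all add: algebra_simps)
  show ?thesis
    unfolding fps2.subspace_def ideal_gen_def scalar_conv_cst
    using span_zero span_add span_scale by blast
qed

section \<open>Values and intersection multiplicities\<close>

context branch_filtration
begin

definition is_val :: "'k fps2 \<Rightarrow> nat \<Rightarrow> bool" where
  "is_val g n \<longleftrightarrow> g \<in> V n \<and> g \<notin> V (Suc n)"

definition val_set :: "nat set" where
  "val_set = {n. \<exists>g. is_val g n}"

lemma V_antimono: "m \<le> n \<Longrightarrow> g \<in> V n \<Longrightarrow> g \<in> V m"
  using lift_Suc_antimono_le[of V m n] V_Suc by blast

lemma V_mult_left: "g \<in> V n \<Longrightarrow> h * g \<in> V n"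
  using V_mult[OF V_0[of h], of g n] by simp

lemma V_mult_right: "g \<in> V n \<Longrightarrow> g * h \<in> V n"
  using V_mult_left[of g n h] by (simp add: mult.commute)

lemma V_minus: "g \<in> V n \<Longrightarrow> - g \<in> V n"
  using V_mult_left[of g n "- 1"] by simp

lemma V_diff: "g \<in> V n \<Longrightarrow> h \<in> V n \<Longrightarrow> g - h \<in> V n"
  using V_add[of g n "- h"] V_minus by simp

lemma V_zero: "0 \<in> V n"
  using V_Inter[of 0] by simp

lemma V_sum: "(\<And>s. s \<in> S \<Longrightarrow> F s \<in> V n) \<Longrightarrow> sum F S \<in> V n"
  by (induction S rule: infinite_finite_induct) (auto intro: V_add V_zero)

lemma V_dvd: "f dvd g \<Longrightarrow> g \<in> V n"
  using V_Inter by blast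

lemma subspace_V: "fps2.subspace (V n)"
  unfolding fps2.subspace_def by (auto simp: scalar_conv_cst intro: V_zero V_add V_mult_left)

lemma V_power: "g \<in> V n \<Longrightarrow> g ^ k \<in> V (k * n)"
  by (induction k) (auto intro: V_mult V_0)

lemma is_val_unique: "is_val g m \<Longrightarrow> is_val g n \<Longrightarrow> m = n"
  unfolding is_val_def using V_antimono by (metis Suc_leI linorder_neqE_nat)

lemma is_val_exists: "\<not> f dvd g \<Longrightarrow> \<exists>n. is_val g n"
proof -
  assume "\<not> f dvd g"
  then obtain n where "g \<notin> V n" using V_Inter by blast
  define m where "m = (LEAST n. g \<notin> V n)"
  have m: "g \<notin> V m" using \<open>g \<notin> V n\<close> unfolding m_def by (rule LeastI)
  then obtain l where l: "m = Suc l" using V_0 by (cases m) auto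
  hence "g \<in> V l" using not_less_Least[of l "\<lambda>n. g \<notin> V n"] by (auto simp: m_def)
  thus ?thesis using m l by (auto simp: is_val_def)
qed

lemma is_val_not_dvd: "is_val g n \<Longrightarrow> \<not> f dvd g"
  using V_dvd by (auto simp: is_val_def)

lemma is_val_mult: "is_val g m \<Longrightarrow> is_val h n \<Longrightarrow> is_val (g * h) (m + n)"
  unfolding is_val_def using V_mult[of g m h n] V_mult_exact[of g m h n] by simp

lemma is_val_add: "is_val g n \<Longrightarrow> h \<in> V (Suc n) \<Longrightarrow> is_val (g + h) n"
  unfolding is_val_def using V_add[of g n h] V_antimono[of n "Suc n" h] V_diff[of "g + h" "Suc n" h]
  by auto

lemma is_val_ge: "is_val g n \<Longrightarrow> g \<in> V m \<Longrightarrow> m \<le> n"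
  unfolding is_val_def using V_antimono[of "Suc n" m g] by (meson not_less_eq_eq)

lemma is_val_1: "is_val 1 0"
proof -
  have "1 \<notin> V (Suc 0)"
  proof
    assume "1 \<in> V (Suc 0)"
    from V_power[OF this] have "1 \<in> V n" for n by simp
    hence "f dvd 1" using V_Inter by blast
    thus False using wt_geD[OF f_ord, of 0 0] by (simp add: unit_fps2_iff)
  qed
  thus ?thesis by (simp add: is_val_def V_0)
qed

lemma is_val_unit:
  assumes "u dvd 1" shows "is_val u 0"
proof -
  from assms obtain v where "1 = u * v" by (elim dvdE)
  hence "u \<notin> V (Suc 0)" using is_val_1 V_mult_right[of u "Suc 0" v] by (auto simp: is_val_def)
  thus ?thesis by (simp add: is_val_def V_0)
qed

lemma is_val_mult_unit: "is_val g n \<Longrightarrow> u dvd 1 \<Longrightarrow> is_val (u * g) n"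
  using is_val_mult[OF is_val_unit, of u g n] by simp

lemma cst_unit: "c \<noteq> 0 \<Longrightarrow> (cst c :: 'k fps2) dvd 1"
  by (simp add: unit_fps2_iff cst_nth)

lemma is_val_power: "is_val g n \<Longrightarrow> is_val (g ^ k) (k * n)"
  by (induction k) (auto intro: is_val_mult is_val_1)

text \<open>For g without constant term, \<open>V_lead\<close> against 1 yields a constant c such
  that g - c has positive value. Then g - c is not a unit, which forces c = 0.\<close>

lemma V_1_iff: "g \<in> V 1 \<longleftrightarrow> g $ 0 $ 0 = 0"
proof
  assume "g \<in> V 1"
  thus "g $ 0 $ 0 = 0" using is_val_unit[of g] by (auto simp: unit_fps2_iff is_val_def)
next
  assume g: "g $ 0 $ 0 = 0"
  have "\<exists>c. g - cst c * 1 \<in> V (Suc 0)"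
    using is_val_1 by (intro V_lead) (auto simp: is_val_def V_0)
  then obtain c where c: "g - cst c \<in> V 1" by auto
  hence "\<not> (g - cst c) dvd 1" using is_val_unit by (auto simp: is_val_def)
  hence "c = 0" using g by (simp add: unit_fps2_iff cst_nth)
  thus "g \<in> V 1" using c by (simp add: cst_simps)
qed

lemma val_set_add: "m \<in> val_set \<Longrightarrow> n \<in> val_set \<Longrightarrow> m + n \<in> val_set"
  unfolding val_set_def using is_val_mult by blast

lemma val_set_cofinite: "\<exists>C. \<forall>n\<ge>C. n \<in> val_set"
  using V_cofinite by (auto simp: val_set_def is_val_def)

lemma is_val_witness: "\<exists>b. \<forall>s\<in>val_set. is_val (b s) s"
  by (rule bchoice) (simp add: val_set_def)

text \<open>Terms of distinct values cannot cancel: the least index with nonzero coefficient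
  decides.\<close>

lemma is_val_sum:
  assumes "finite T" "\<And>s. s \<in> T \<Longrightarrow> is_val (e s) s" "t \<in> T" "c t \<noteq> 0"
  shows "\<exists>s\<in>T. is_val (\<Sum>s\<in>T. cst (c s) * e s) s"
proof -
  define s where "s = Min {s\<in>T. c s \<noteq> 0}"
  have ne: "{s\<in>T. c s \<noteq> 0} \<noteq> {}" "finite {s\<in>T. c s \<noteq> 0}" using assms by auto
  have s: "s \<in> T" "c s \<noteq> 0" using Min_in[OF ne(2,1)] by (auto simp: s_def)
  have "(\<Sum>r\<in>T - {s}. cst (c r) * e r) \<in> V (Suc s)"
  proof (rule V_sum)
    fix r assume r: "r \<in> T - {s}"
    show "cst (c r) * e r \<in> V (Suc s)"
    proof (cases "c r = 0")
      case False
      hence "s < r" using r Min_le[OF ne(2), of r] by (auto simp: s_def)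
      thus ?thesis using assms(2)[of r] r by (intro V_mult_left V_antimono[of "Suc s" r]) (auto simp: is_val_def)
    qed (simp add: cst_simps V_zero)
  qed
  from is_val_add[OF is_val_mult_unit[OF assms(2)[OF s(1)] cst_unit[OF s(2)]] this]
  have "is_val (\<Sum>r\<in>T. cst (c r) * e r) s"
    using assms(1) s(1) by (simp add: sum.remove)
  thus ?thesis using s(1) by blast
qed

text \<open>Leading terms are removed value by value. At a gap of \<open>val_set\<close> two
  consecutive sets of the filtration coincide and nothing has to be removed.\<close>

lemma V_approx:
  assumes "v \<in> V n" "\<And>s. s \<in> val_set \<Longrightarrow> n \<le> s \<Longrightarrow> s < n + K \<Longrightarrow> is_val (e s) s"
  shows "\<exists>c. v - (\<Sum>s\<in>val_set \<inter> {n..<n + K}. cst (c s) * e s) \<in> V (n + K)"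
  using assms(2)
proof (induction K)
  case 0
  thus ?case using assms(1) by simp
next
  case (Suc K)
  then obtain c where c: "v - (\<Sum>s\<in>val_set \<inter> {n..<n + K}. cst (c s) * e s) \<in> V (n + K)"
    by auto
  show ?case
  proof (cases "n + K \<in> val_set")
    case True
    have "is_val (e (n + K)) (n + K)" using Suc.prems True by simp
    then obtain a where a: "v - (\<Sum>s\<in>val_set \<inter> {n..<n + K}. cst (c s) * e s) - cst a * e (n + K) \<in> V (Suc (n + K))"
      using V_lead[OF c] by (auto simp: is_val_def)
    have I: "val_set \<inter> {n..<n + Suc K} = insert (n + K) (val_set \<inter> {n..<n + K})" using True by auto
    have "(\<Sum>s\<in>val_set \<inter> {n..<n + K}. cst ((c(n + K := a)) s) * e s) = (\<Sum>s\<in>val_set \<inter> {n..<n + K}. cst (c s) * e s)"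
      by (intro sum.cong) auto
    hence "v - (\<Sum>s\<in>val_set \<inter> {n..<n + Suc K}. cst ((c(n + K := a)) s) * e s) \<in> V (n + Suc K)"
      unfolding I using a by (simp add: algebra_simps)
    thus ?thesis by blast
  next
    case False
    hence I: "val_set \<inter> {n..<n + Suc K} = val_set \<inter> {n..<n + K}" by (auto simp: less_Suc_eq)
    from False c have "v - (\<Sum>s\<in>val_set \<inter> {n..<n + K}. cst (c s) * e s) \<in> V (Suc (n + K))"
      by (auto simp: val_set_def is_val_def)
    thus ?thesis unfolding I by auto
  qed
qed

lemma is_val_var_x: obtains m where "m > 0" "is_val var_x m"
proof -
  have "\<not> f dvd var_x"
  proof
    assume "f dvd var_x"
    then obtain h where "var_x = f * h" by (elim dvdE)
    hence "(var_x :: 'k fps2) \<in> ord_ge 2" using wt_ge_mult_right[OF f_ord, of h] by simp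
    from wt_geD[OF this, of 1 0] show False by (simp add: var_x_nth)
  qed
  then obtain m where m: "is_val var_x m" using is_val_exists by blast
  have "var_x \<in> V 1" unfolding V_1_iff by (simp add: var_x_nth)
  from is_val_ge[OF m this] have "m > 0" by simp
  thus thesis using m by (rule that)
qed

text \<open>Every s \<ge> n + C is the value of a multiple of g, since s - n is a value. Leading
  terms are removed in blocks of length m, the value of x: in block i the multiplier can carry the
  factor x^i and still leave a value of at least C. The multipliers thus sum x-adically, and what
  remains has infinite value, that is, f divides it.\<close>

lemma conductor_in_ideal:
  assumes g: "is_val g n" and C: "\<And>s. s \<ge> C \<Longrightarrow> s \<in> val_set" and v: "v \<in> V (n + C)"
  shows "v \<in> ideal_gen {f, g}"
proof -
  obtain m where m: "m > 0" "is_val var_x m" by (rule is_val_var_x)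
  obtain b where b: "\<And>s. s \<in> val_set \<Longrightarrow> is_val (b s) s"
    using is_val_witness by blast
  have "\<exists>q. w - g * (q * var_x ^ i) \<in> V (n + C + Suc i * m)" if w: "w \<in> V (n + C + i * m)" for i w
  proof -
    let ?I = "val_set \<inter> {n + C + i * m..<n + C + i * m + m}"
    have "is_val (g * var_x ^ i * b (s - n - i * m)) s" if "n + C + i * m \<le> s" for s
    proof -
      have "is_val (b (s - n - i * m)) (s - n - i * m)" using that by (intro b C) simp
      from is_val_mult[OF is_val_mult[OF g is_val_power[OF m(2), of i]] this]
      show ?thesis using that by simp
    qed
    with V_approx[OF w, of m "\<lambda>s. g * var_x ^ i * b (s - n - i * m)"] obtain c where
      "w - (\<Sum>s\<in>?I. cst (c s) * (g * var_x ^ i * b (s - n - i * m))) \<in> V (n + C + i * m + m)" by blast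
    also have "(\<Sum>s\<in>?I. cst (c s) * (g * var_x ^ i * b (s - n - i * m))) =
        g * ((\<Sum>s\<in>?I. cst (c s) * b (s - n - i * m)) * var_x ^ i)"
      by (simp add: sum_distrib_left sum_distrib_right mult_ac)
    finally show ?thesis
      by (intro exI[of _ "\<Sum>s\<in>?I. cst (c s) * b (s - n - i * m)"]) (simp add: add.commute add.left_commute)
  qed
  hence "\<forall>i w. \<exists>q. w \<in> V (n + C + i * m) \<longrightarrow> w - g * (q * var_x ^ i) \<in> V (n + C + Suc i * m)"
    by blast
  from this[unfolded choice_iff] obtain q where
    q: "\<And>i w. w \<in> V (n + C + i * m) \<Longrightarrow> w - g * (q i w * var_x ^ i) \<in> V (n + C + Suc i * m)"
    by blast
  define w where "w = rec_nat v (\<lambda>i u. u - g * (q i u * var_x ^ i))"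
  have w_simps: "w 0 = v" "w (Suc i) = w i - g * (q i (w i) * var_x ^ i)" for i
    by (simp_all add: w_def)
  have wV: "w i \<in> V (n + C + i * m)" for i
  proof (induction i)
    case (Suc i)
    thus ?case using q[of "w i" i] by (simp only: w_simps)
  qed (simp add: v w_simps)
  have vw: "v = g * (\<Sum>k<i. q k (w k) * var_x ^ k) + w i" for i
    by (induction i) (simp_all add: w_simps algebra_simps)
  obtain S r where S: "\<And>i. S = (\<Sum>k<i. q k (w k) * var_x ^ k) + var_x ^ i * r i"
    using x_adic_limit[of "\<lambda>k. q k (w k)"] by blast
  have "v - g * S \<in> V i" for i
  proof -
    have "v - g * S = w i - g * (var_x ^ i * r i)"
      by (subst vw[of i], subst S[of i]) (simp add: algebra_simps)
    moreover have "i \<le> i * m" using m by simp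
    hence "i \<le> n + C + i * m" by linarith
    hence "w i \<in> V i" using wV V_antimono by blast
    moreover have "var_x ^ i \<in> V i"
      using V_antimono[OF \<open>i \<le> i * m\<close>] is_val_power[OF m(2), of i] by (auto simp: is_val_def)
    ultimately show ?thesis by (auto intro: V_diff V_mult_left V_mult_right)
  qed
  hence "f dvd v - g * S" using V_Inter by blast
  thus ?thesis unfolding ideal_gen_pair by blast
qed

theorem intersection_mult_eq_val:
  assumes g: "is_val g n"
  shows "intersection_mult f g = enat n"
proof -
  obtain C where C: "\<And>s. s \<ge> C \<Longrightarrow> s \<in> val_set" using val_set_cofinite by blast
  obtain b where b: "\<And>s. s \<in> val_set \<Longrightarrow> is_val (b s) s"
    using is_val_witness by blast
  \<comment> \<open>An element of the ideal not divisible by f has the value of some g h, which is n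
    plus a value. So the values outside that set should index a basis.\<close>
  define S where "S = val_set - (+) n ` val_set"
  let ?W = "ideal_gen {f, g}"
  have nC: "s \<in> (+) n ` val_set" if "s \<ge> n + C" for s
    using that C[of "s - n"] by (intro image_eqI[of _ _ "s - n"]) auto
  have S: "S \<subseteq> val_set" "S \<subseteq> {..<n + C}" using nC by (force simp: S_def not_less[symmetric])+
  have finS: "finite S" using S(2) finite_subset by blast
  have n: "n \<in> val_set" using g by (auto simp: val_set_def)
  \<comment> \<open>The values below n + C are counted twice: as S and the shifted values below C,
    and as the values below C and the n integers from C on.\<close>
  have cardS: "card S = n"
  proof -
    have "val_set \<inter> {..<n + C} = S \<union> (+) n ` (val_set \<inter> {..<C})"
      using S val_set_add[OF n] by (auto simp: S_def)
    moreover have "S \<inter> (+) n ` (val_set \<inter> {..<C}) = {}" by (auto simp: S_def)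
    ultimately have "card (val_set \<inter> {..<n + C}) = card S + card (val_set \<inter> {..<C})"
      using finS by (simp add: card_Un_disjoint card_image)
    moreover have "val_set \<inter> {..<n + C} = (val_set \<inter> {..<C}) \<union> {C..<n + C}"
      using C by auto
    hence "card (val_set \<inter> {..<n + C}) = card (val_set \<inter> {..<C}) + n"
      by (simp add: card_Un_disjoint Int_def)
    ultimately show ?thesis by simp
  qed
  have indep: "c s = 0" if c: "(\<Sum>s\<in>S. scalar (c s) (b s)) \<in> ?W" "s \<in> S" for c s
  proof (rule ccontr)
    assume "c s \<noteq> 0"
    with is_val_sum[OF finS b, of s c] S c(2) obtain t where
      t: "t \<in> S" "is_val (\<Sum>s\<in>S. scalar (c s) (b s)) t" by (auto simp: scalar_conv_cst)
    obtain h where h: "f dvd (\<Sum>s\<in>S. scalar (c s) (b s)) - g * h"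
      using c(1) unfolding ideal_gen_pair by blast
    have gh: "is_val (g * h) t"
      using is_val_add[OF t(2) V_minus[OF V_dvd[OF h]]] by simp
    hence "\<not> f dvd h" using is_val_not_dvd by (meson dvd_mult)
    then obtain k where "is_val h k" using is_val_exists by blast
    hence "t = n + k" "k \<in> val_set" using is_val_mult[OF g] gh is_val_unique by (auto simp: val_set_def)
    thus False using t(1) by (auto simp: S_def)
  qed
  have inj: "inj_on b S"
    by (rule inj_onI) (metis S(1) b in_mono is_val_unique)
  have "quotient_basis ?W (b ` S)"
    unfolding quotient_basis_def
  proof (intro conjI allI impI ballI)
    show "finite (b ` S)" using finS by simp
    fix c v assume "(\<Sum>v\<in>b ` S. scalar (c v) v) \<in> ?W" "v \<in> b ` S"
    thus "c v = 0" using indep[of "\<lambda>s. c (b s)"] by (auto simp: sum.reindex[OF inj])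
  next
    fix v
    \<comment> \<open>Values outside S are realised by multiples of g, so that their part of the
      approximation lies in the ideal.\<close>
    define e where "e s = (if s \<in> S then b s else g * b (s - n))" for s
    have e: "is_val (e s) s" if s: "s \<in> val_set" for s
    proof (cases "s \<in> S")
      case False
      then obtain k where k: "s = n + k" "k \<in> val_set" using s by (auto simp: S_def)
      thus ?thesis using False is_val_mult[OF g b[of k]] by (simp add: e_def)
    qed (simp add: e_def b s)
    let ?I = "val_set \<inter> {0..<0 + (n + C)}"
    obtain c where c: "v - (\<Sum>s\<in>?I. cst (c s) * e s) \<in> V (0 + (n + C))"
      using V_approx[OF V_0[of v], of "n + C" e] e by blast
    have I: "?I = S \<union> (?I - S)" using S by auto
    have "(\<Sum>s\<in>?I. cst (c s) * e s) = (\<Sum>s\<in>S. cst (c s) * e s) + (\<Sum>s\<in>?I - S. cst (c s) * e s)"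
      by (subst I, rule sum.union_disjoint) (use finS in auto)
    also have "(\<Sum>s\<in>?I - S. cst (c s) * e s) = g * (\<Sum>s\<in>?I - S. cst (c s) * b (s - n))"
      unfolding sum_distrib_left by (intro sum.cong) (auto simp: e_def)
    also have "(\<Sum>s\<in>S. cst (c s) * e s) = (\<Sum>s\<in>S. scalar (c s) (b s))"
      by (intro sum.cong) (auto simp: e_def scalar_conv_cst)
    also have "\<dots> = (\<Sum>u\<in>b ` S. scalar (c (inv_into S b u)) u)"
      by (simp add: sum.reindex[OF inj] inj)
    finally have *: "(\<Sum>s\<in>?I. cst (c s) * e s) = (\<Sum>u\<in>b ` S. scalar (c (inv_into S b u)) u) +
      g * (\<Sum>s\<in>?I - S. cst (c s) * b (s - n))" .
    have "v - (\<Sum>s\<in>?I. cst (c s) * e s) \<in> ?W"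
      by (rule conductor_in_ideal[OF g C]) (use c in auto)
    then obtain h where "f dvd v - (\<Sum>s\<in>?I. cst (c s) * e s) - g * h" by (auto simp: ideal_gen_pair)
    hence "f dvd (v - (\<Sum>u\<in>b ` S. scalar (c (inv_into S b u)) u)) -
        g * ((\<Sum>s\<in>?I - S. cst (c s) * b (s - n)) + h)"
      unfolding * by (simp add: algebra_simps)
    thus "\<exists>c. v - (\<Sum>u\<in>b ` S. scalar (c u) u) \<in> ?W"
      unfolding ideal_gen_pair by (intro exI)
  qed
  moreover have "card (b ` S) = n" using cardS by (simp add: card_image inj)
  moreover have "n \<le> card B" if B: "quotient_basis ?W B" for B
  proof -
    have "card S \<le> card B"
    proof (rule card_le_of_independent_mod[OF subspace_ideal_gen_pair])
      show "finite B" using B by (simp add: quotient_basis_def)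
      fix v
      from B obtain c where "v - (\<Sum>b\<in>B. scalar (c b) b) \<in> ?W"
        unfolding quotient_basis_def by blast
      moreover have "(\<Sum>b\<in>B. scalar (c b) b) \<in> fps2.span B"
        by (intro fps2.span_sum fps2.span_scale fps2.span_base)
      ultimately show "\<exists>u\<in>fps2.span B. v - u \<in> ?W" by blast
    qed (use finS indep in auto)
    thus ?thesis by (simp add: cardS)
  qed
  ultimately show ?thesis
    unfolding intersection_mult_def quotient_dim_def
    by (intro antisym Inf_lower Inf_greatest) auto
qed

theorem value_semigroup_eq: "value_semigroup f = val_set"
proof (intro set_eqI iffI)
  fix n assume "n \<in> value_semigroup f"
  then obtain g where g: "\<not> f dvd g" "intersection_mult f g = enat n"
    unfolding value_semigroup_def ideal_gen_singleton by blast
  then obtain m where m: "is_val g m" using is_val_exists by blast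
  thus "n \<in> val_set" using intersection_mult_eq_val[OF m] g by (auto simp: val_set_def)
next
  fix n assume "n \<in> val_set"
  then obtain g where g: "is_val g n" by (auto simp: val_set_def)
  thus "n \<in> value_semigroup f"
    unfolding value_semigroup_def ideal_gen_singleton
    using is_val_not_dvd[OF g] intersection_mult_eq_val[OF g] by blast
qed

end

lemma branch_filtration_transport:
  assumes "branch_filtration f V" and \<tau>: "alg_hom \<tau>" and \<sigma>: "alg_hom \<sigma>"
    and inv: "\<And>g. \<tau> (\<sigma> g) = g" "\<And>g. \<sigma> (\<tau> g) = g"
    and loc: "\<tau> var_x \<in> ord_ge 1" "\<tau> var_y \<in> ord_ge 1"
  shows "branch_filtration (\<tau> f) (\<lambda>n. {g. \<sigma> g \<in> V n})"
proof -
  interpret branch_filtration f V by fact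
  note s = alg_hom_simps[OF \<sigma>] and t = alg_hom_simps[OF \<tau>]
  show ?thesis
  proof
    show "\<tau> f \<in> ord_ge 2" by (rule alg_hom_ord_ge[OF \<tau> loc f_ord])
    fix g h n m
    show "g \<in> {g. \<sigma> g \<in> V 0}" using V_0 by simp
    show "{g. \<sigma> g \<in> V (Suc n)} \<subseteq> {g. \<sigma> g \<in> V n}" using V_Suc by blast
    show "g \<in> {g. \<sigma> g \<in> V n} \<Longrightarrow> h \<in> {g. \<sigma> g \<in> V n} \<Longrightarrow> g + h \<in> {g. \<sigma> g \<in> V n}"
      using V_add by (simp add: s)
    show "g \<in> {g. \<sigma> g \<in> V n} \<Longrightarrow> h \<in> {g. \<sigma> g \<in> V m} \<Longrightarrow> g * h \<in> {g. \<sigma> g \<in> V (n + m)}"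
      using V_mult by (simp add: s)
    show "g \<in> {g. \<sigma> g \<in> V n} - {g. \<sigma> g \<in> V (Suc n)} \<Longrightarrow>
      h \<in> {g. \<sigma> g \<in> V m} - {g. \<sigma> g \<in> V (Suc m)} \<Longrightarrow> g * h \<notin> {g. \<sigma> g \<in> V (Suc (n + m))}"
      using V_mult_exact by (simp add: s)
    show "g \<in> {g. \<sigma> g \<in> V n} \<Longrightarrow> h \<in> {g. \<sigma> g \<in> V n} - {g. \<sigma> g \<in> V (Suc n)} \<Longrightarrow>
       \<exists>c. g - cst c * h \<in> {g. \<sigma> g \<in> V (Suc n)}"
      using V_lead[of "\<sigma> g" n "\<sigma> h"] by (simp add: s)
    have "f dvd \<sigma> g \<longleftrightarrow> \<tau> f dvd g"
    proof
      assume "f dvd \<sigma> g"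
      then obtain h where "\<sigma> g = f * h" by (elim dvdE)
      hence "\<tau> (\<sigma> g) = \<tau> f * \<tau> h" by (simp add: t)
      thus "\<tau> f dvd g" by (simp add: inv)
    next
      assume "\<tau> f dvd g"
      then obtain h where "g = \<tau> f * h" by (elim dvdE)
      thus "f dvd \<sigma> g" by (simp add: s inv)
    qed
    thus "(\<forall>n. g \<in> {g. \<sigma> g \<in> V n}) \<longleftrightarrow> \<tau> f dvd g" using V_Inter by simp
    show "\<exists>C. \<forall>n\<ge>C. \<exists>g. g \<in> {g. \<sigma> g \<in> V n} - {g. \<sigma> g \<in> V (Suc n)}"
    proof -
      from V_cofinite obtain C where C: "\<And>n. n \<ge> C \<Longrightarrow> \<exists>g. g \<in> V n - V (Suc n)" by blast
      have "\<exists>g. \<sigma> g \<in> V n \<and> \<sigma> g \<notin> V (Suc n)" if "n \<ge> C" for n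
      proof -
        from C[OF that] obtain g where "g \<in> V n - V (Suc n)" by blast
        thus ?thesis by (intro exI[of _ "\<tau> g"]) (simp add: inv)
      qed
      thus ?thesis by auto
    qed
  qed
qed

section \<open>Adapted coordinates\<close>

lemma fps_const_decomp:
  fixes q :: "'k::field fps"
  assumes "q \<noteq> 0"
  obtains r u where "fps_const q = u * var_x ^ r" "u dvd 1"
proof
  let ?u = "fps_const (fps_shift (subdegree q) q)"
  show "fps_const q = ?u * var_x ^ subdegree q"
    by (subst subdegree_decompose) (simp add: var_x_power)
  show "?u dvd 1" using assms by (simp add: unit_fps2_iff)
qed

lemma decomp_mod_y: "F = fps_const (F $ 0) + var_y * low_y F"
proof (rule fps2_eqI)
  fix i j
  show "F $ j $ i = (fps_const (F $ 0) + var_y * low_y F) $ j $ i"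
    by (simp only: fps_add_nth var_y_mult_nth) (simp add: low_y_def)
qed

lemma nat_span_empty: "nat_span {} = {0}"
  by (auto simp: nat_span_def)

lemma nat_span_pair:
  assumes "n \<in> nat_span {a, b}"
  obtains i j where "n = a * i + b * j"
proof -
  from assms obtain T c where T: "T \<subseteq> {a, b}" "n = (\<Sum>t\<in>T. c t * t)"
    by (auto simp: nat_span_def)
  have "n = (\<Sum>t\<in>{a, b}. if t \<in> T then c t * t else 0)"
    unfolding T(2) using T(1) by (intro sum.mono_neutral_cong_left) auto
  \<comment> \<open>For a = b the sum has a single term, so the second coefficient must be
    0.\<close>
  also have "\<dots> = a * (if a \<in> T then c a else 0) + b * (if b \<in> T \<and> a \<noteq> b then c b else 0)"
    by (cases "a = b") (simp_all add: mult.commute)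
  finally show thesis by (rule that)
qed

lemma nat_span_singleton: "n \<in> nat_span {a} \<longleftrightarrow> a dvd n"
proof
  assume "n \<in> nat_span {a}"
  then obtain i j where "n = a * i + a * j" using nat_span_pair[of n a a] by auto
  thus "a dvd n" by simp
next
  assume "a dvd n"
  then obtain k where "n = a * k" by (elim dvdE)
  hence "n = (\<Sum>t\<in>{a}. k * t)" by simp
  thus "n \<in> nat_span {a}" unfolding nat_span_def
    by (intro CollectI exI[of _ "{a}"] exI[of _ "\<lambda>_. k"]) auto
qed

context branch_filtration
begin

lemma not_dvd_of_linear_term:
  assumes "F $ 1 $ 0 \<noteq> 0 \<or> F $ 0 $ 1 \<noteq> 0"
  shows "\<not> f dvd F"
proof
  assume "f dvd F"
  then obtain h where h: "F = f * h" by (elim dvdE)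
  have "F \<in> ord_ge 2" unfolding h by (rule wt_ge_mult_right, rule f_ord)
  thus False using wt_geD[of F 1 1 2 1 0] wt_geD[of F 1 1 2 0 1] assms by auto
qed

lemma is_val_pos:
  assumes "is_val g n" "g $ 0 $ 0 = 0"
  shows "n > 0"
  using is_val_ge[OF assms(1), of 1] V_1_iff assms(2) by simp

text \<open>A nonzero series in x alone is a power of x times a unit.\<close>

lemma is_val_fps_const:
  assumes a: "is_val var_x a" and n: "is_val (fps_const q) n"
  shows "a dvd n"
proof -
  have "q \<noteq> 0" using is_val_not_dvd[OF n] by auto
  then obtain r u where "fps_const q = u * var_x ^ r" "u dvd 1" by (rule fps_const_decomp)
  hence "is_val (fps_const q) (r * a)" using is_val_mult_unit[OF is_val_power[OF a]] by simp
  hence "n = r * a" using n is_val_unique by blast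
  thus ?thesis by simp
qed

text \<open>Otherwise every y - q(x) has value divisible by a, so a multiple of a power of x matches
  its leading term and subtracting it raises the value. In the limit f divides y - S for some S
  divisible by x, although y - S has a linear term and f has order at least 2.\<close>

lemma shear_exists:
  assumes a: "is_val var_x a" and y: "var_y \<in> V a"
  obtains q n where "q $ 0 = 0" "is_val (var_y - fps_const q) n" "\<not> a dvd n"
proof (rule ccontr)
  assume "\<not> thesis"
  hence H: "a dvd n" if "q $ 0 = 0" "is_val (var_y - fps_const q) n" for q n
    using that \<open>\<And>n q. q $ 0 = 0 \<Longrightarrow> is_val (var_y - fps_const q) n \<Longrightarrow> \<not> a dvd n \<Longrightarrow> thesis\<close> by blast
  have apos: "a > 0" using is_val_pos[OF a] by (simp add: var_x_nth)
  have ex: "\<exists>c. var_y - fps_const (q + fps_const c * fps_X ^ Suc k) \<in> V (Suc (Suc k) * a)"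
    if q: "q $ 0 = 0" "var_y - fps_const q \<in> V (Suc k * a)" for q k
  proof -
    have "is_val (var_x ^ Suc k) (Suc k * a)" by (rule is_val_power[OF a])
    then obtain c where c: "(var_y - fps_const q) - cst c * var_x ^ Suc k \<in> V (Suc (Suc k * a))"
      using V_lead[OF q(2)] unfolding is_val_def by blast
    let ?q = "q + fps_const c * fps_X ^ Suc k"
    have eq: "(var_y - fps_const q) - cst c * var_x ^ Suc k = var_y - fps_const ?q"
      by (simp only: var_x_power cst_def fps_const_mult fps_const_add[symmetric] diff_diff_eq)
    have q0: "?q $ 0 = 0" using q by simp
    have "\<not> f dvd var_y - fps_const ?q"
      by (rule not_dvd_of_linear_term) (simp add: var_y_nth)
    then obtain n where n: "is_val (var_y - fps_const ?q) n" using is_val_exists by blast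
    obtain m where m: "n = m * a" using H[OF q0 n] by (metis dvdE mult.commute)
    \<comment> \<open>The value exceeds (k + 1)a and is a multiple of a, so it is at least (k +
      2)a.\<close>
    have "Suc (Suc k * a) \<le> n" using is_val_ge[OF n] c unfolding eq by blast
    hence "Suc k * a < m * a" unfolding m by simp
    hence "Suc (Suc k) \<le> m" by (simp only: mult_less_cancel2) simp
    hence "Suc (Suc k) * a \<le> n" unfolding m by (rule mult_right_mono) simp
    thus ?thesis using V_antimono n unfolding is_val_def by blast
  qed
  hence "\<forall>k q. \<exists>c. q $ 0 = 0 \<and> var_y - fps_const q \<in> V (Suc k * a) \<longrightarrow>
      var_y - fps_const (q + fps_const c * fps_X ^ Suc k) \<in> V (Suc (Suc k) * a)" by blast
  from this[unfolded choice_iff] obtain c where c: "\<And>k q. q $ 0 = 0 \<Longrightarrow> var_y - fps_const q \<in> V (Suc k * a) \<Longrightarrow>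
      var_y - fps_const (q + fps_const (c k q) * fps_X ^ Suc k) \<in> V (Suc (Suc k) * a)"
    by blast
  define Q where "Q = rec_nat 0 (\<lambda>k q. q + fps_const (c k q) * fps_X ^ Suc k)"
  have Q_simps: "Q 0 = 0" "Q (Suc k) = Q k + fps_const (c k (Q k)) * fps_X ^ Suc k" for k
    by (simp_all add: Q_def)
  have Q0: "Q k $ 0 = 0" for k by (induction k) (simp_all add: Q_simps)
  have QV: "var_y - fps_const (Q k) \<in> V (Suc k * a)" for k
  proof (induction k)
    case (Suc k)
    show ?case unfolding Q_simps by (rule c[OF Q0 Suc])
  qed (simp add: Q_simps y)
  define p where "p k = cst (c k (Q k)) * var_x" for k
  have Qp: "fps_const (Q n) = (\<Sum>k<n. p k * var_x ^ k)" for n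
  proof (induction n)
    case (Suc n)
    have "fps_const (Q (Suc n)) = fps_const (Q n) + cst (c n (Q n)) * var_x ^ Suc n"
      by (simp only: var_x_power cst_def fps_const_mult fps_const_add[symmetric] Q_simps)
    thus ?case using Suc by (simp add: p_def algebra_simps)
  qed (simp add: Q_simps)
  obtain S r where S: "\<And>n. S = (\<Sum>k<n. p k * var_x ^ k) + var_x ^ n * r n"
    using x_adic_limit[of p] by blast
  have "var_y - S \<in> V n" for n
  proof -
    have eq: "var_y - S = (var_y - fps_const (Q n)) - var_x ^ n * r n"
      by (subst S[of n]) (simp add: Qp)
    have "n * 1 \<le> n * a" using apos by (intro mult_left_mono) auto
    moreover have "n * a \<le> Suc n * a" by simp
    ultimately have "n \<le> n * a" "n \<le> Suc n * a" by linarith+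
    hence "var_y - fps_const (Q n) \<in> V n" "var_x ^ n \<in> V n"
      using QV[of n] is_val_power[OF a, of n] V_antimono unfolding is_val_def by blast+
    thus ?thesis unfolding eq using V_diff V_mult_right by blast
  qed
  hence "f dvd var_y - S" using V_Inter by blast
  moreover have "S = var_x * (cst (c 0 (Q 0)) + r 1)"
    using S[of 1] by (simp add: p_def algebra_simps)
  hence "S $ 1 $ 0 = 0" by (simp only: var_x_mult_nth) simp
  hence "\<not> f dvd var_y - S"
    by (intro not_dvd_of_linear_term disjI1) (simp add: var_y_nth)
  ultimately show False by blast
qed

text \<open>x and y, hence all nonunits, have value at least a. A value below b does not see the
  multiples of y; it is the value of a series in x alone and so a multiple of a.\<close>

lemma min_gen_seq_val_set:
  assumes a: "is_val var_x a" and b: "is_val var_y b" and ab: "\<not> a dvd b" "a \<le> b"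
  shows "min_gen_seq val_set 0 = a" "min_gen_seq val_set 1 = b"
proof -
  have pos: "a > 0" "b > 0" using is_val_pos[OF a] is_val_pos[OF b] by (simp_all add: var_x_nth var_y_nth)
  have in_Va: "g \<in> V a" if "g $ 0 $ 0 = 0" for g
  proof -
    have "var_x \<in> V a" "var_y \<in> V a"
      using a b V_antimono[OF ab(2)] by (auto simp: is_val_def)
    hence "var_x * low_x g + var_y * low_y g \<in> V a" by (intro V_add V_mult_right)
    thus ?thesis using low_decomp[of g] that by (simp add: cst_simps)
  qed
  have val_ge: "a \<le> n" if n: "is_val g n" "n \<noteq> 0" for g n
  proof -
    have "g $ 0 $ 0 = 0"
      using is_val_unit[of g] is_val_unique[OF n(1)] n(2) unit_fps2_iff by blast
    from is_val_ge[OF n(1) in_Va[OF this]] show ?thesis .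
  qed
  show m0: "min_gen_seq val_set 0 = a"
    by (subst min_gen_seq.simps, rule Least_equality) (use a pos val_ge in \<open>auto simp: nat_span_empty val_set_def\<close>)
  have "b \<le> n" if n: "is_val g n" "\<not> a dvd n" for g n
  proof (rule ccontr)
    assume "\<not> b \<le> n"
    hence "var_y * low_y g \<in> V (Suc n)"
      using b V_antimono[of "Suc n" b var_y] V_mult_right by (simp add: is_val_def)
    from is_val_add[OF n(1) V_minus[OF this]] have "is_val (fps_const (g $ 0)) n"
      by (subst (asm) (1) decomp_mod_y) simp
    from is_val_fps_const[OF a this] n(2) show False by simp
  qed
  hence "(LEAST n. n \<in> val_set - nat_span {a}) = b"
    by (intro Least_equality) (use ab b in \<open>auto simp: nat_span_singleton val_set_def\<close>)
  thus "min_gen_seq val_set 1 = b"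
    by (subst min_gen_seq.simps) (simp add: m0 lessThan_Suc)
qed

end

section \<open>Changes of coordinates\<close>

definition coord_change :: "('k::comm_ring_1 fps2 \<Rightarrow> 'k fps2) \<Rightarrow> ('k fps2 \<Rightarrow> 'k fps2) \<Rightarrow> bool" where
  "coord_change \<tau> \<sigma> \<longleftrightarrow> alg_hom \<tau> \<and> alg_hom \<sigma> \<and> (\<forall>g. \<tau> (\<sigma> g) = g) \<and> (\<forall>g. \<sigma> (\<tau> g) = g) \<and>
     \<tau> var_x \<in> ord_ge 1 \<and> \<tau> var_y \<in> ord_ge 1 \<and> \<sigma> var_x \<in> ord_ge 1 \<and> \<sigma> var_y \<in> ord_ge 1"

lemma coord_change_id: "coord_change (\<lambda>g. g) (\<lambda>g. g)"
  by (simp add: coord_change_def alg_hom_def wt_ge_var)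

lemma coord_change_swap: "coord_change swap_xy swap_xy"
  by (simp add: coord_change_def swap_xy wt_ge_var)

lemma coord_change_comp:
  assumes "coord_change \<tau> \<sigma>" "coord_change \<tau>' \<sigma>'"
  shows "coord_change (\<lambda>g. \<tau> (\<tau>' g)) (\<lambda>g. \<sigma>' (\<sigma> g))"
proof -
  have \<tau>: "alg_hom \<tau>" "alg_hom \<sigma>" "\<tau> var_x \<in> ord_ge 1" "\<tau> var_y \<in> ord_ge 1"
      "\<sigma> var_x \<in> ord_ge 1" "\<sigma> var_y \<in> ord_ge 1"
    and \<tau>': "alg_hom \<tau>'" "alg_hom \<sigma>'" "\<tau>' var_x \<in> ord_ge 1" "\<tau>' var_y \<in> ord_ge 1"
      "\<sigma>' var_x \<in> ord_ge 1" "\<sigma>' var_y \<in> ord_ge 1"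
    using assms by (simp_all add: coord_change_def)
  have "alg_hom (\<lambda>g. \<tau> (\<tau>' g))" "alg_hom (\<lambda>g. \<sigma>' (\<sigma> g))"
    using alg_hom_comp[OF \<tau>(1) \<tau>'(1)] alg_hom_comp[OF \<tau>'(2) \<tau>(2)] .
  moreover have "\<tau> (\<tau>' var_x) \<in> ord_ge 1" "\<tau> (\<tau>' var_y) \<in> ord_ge 1"
    using alg_hom_ord_ge[OF \<tau>(1,3,4)] \<tau>' by blast+
  moreover have "\<sigma>' (\<sigma> var_x) \<in> ord_ge 1" "\<sigma>' (\<sigma> var_y) \<in> ord_ge 1"
    using alg_hom_ord_ge[OF \<tau>'(2,5,6)] \<tau> by blast+
  moreover have "\<tau> (\<tau>' (\<sigma>' (\<sigma> g))) = g" "\<sigma>' (\<sigma> (\<tau> (\<tau>' g))) = g" for g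
    using assms by (simp_all add: coord_change_def)
  ultimately show ?thesis unfolding coord_change_def by blast
qed

lemma coord_change_shear:
  fixes q :: "'k::comm_ring_1 fps"
  assumes "q $ 0 = 0"
  shows "coord_change (subst_y (var_y + fps_const q)) (subst_y (var_y - fps_const q))"
proof -
  have *: "var_y + fps_const q \<in> ord_ge 1" "var_y - fps_const q \<in> ord_ge 1"
    using assms by (auto simp: wt_ge_def var_y_nth)
  note s = subst_y[OF *(1)] and t = subst_y[OF *(2)]
  have c: "subst_y (var_y + fps_const q) (fps_const r) = fps_const r"
      "subst_y (var_y - fps_const q) (fps_const r) = fps_const r" for r
    by (rule subst_y_const)+
  have id: "alg_hom (\<lambda>g :: 'k fps2. g)" by (simp add: alg_hom_def)
  have "subst_y (var_y + fps_const q) (subst_y (var_y - fps_const q) g) = g" for g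
    by (rule alg_hom_unique[OF alg_hom_comp[OF s(1) t(1)] id])
       (simp_all add: s t c alg_hom_simps[OF s(1)] wt_ge_var)
  moreover have "subst_y (var_y - fps_const q) (subst_y (var_y + fps_const q) g) = g" for g
    by (rule alg_hom_unique[OF alg_hom_comp[OF t(1) s(1)] id])
       (simp_all add: s t c alg_hom_simps[OF t(1)] wt_ge_var)
  ultimately show ?thesis
    unfolding coord_change_def using s t * by (simp add: wt_ge_var)
qed

lemma coord_change_filtration:
  assumes V: "branch_filtration f V" and c: "coord_change \<tau> \<sigma>"
  shows "branch_filtration (\<tau> f) (\<lambda>n. {g. \<sigma> g \<in> V n})"
    and "branch_filtration.is_val (\<lambda>n. {g. \<sigma> g \<in> V n}) g n = branch_filtration.is_val V (\<sigma> g) n"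
    and "branch_filtration.val_set (\<lambda>n. {g. \<sigma> g \<in> V n}) = branch_filtration.val_set V"
proof -
  interpret V: branch_filtration f V by fact
  show "branch_filtration (\<tau> f) (\<lambda>n. {g. \<sigma> g \<in> V n})"
    using c by (intro branch_filtration_transport V) (auto simp: coord_change_def)
  then interpret W: branch_filtration "\<tau> f" "\<lambda>n. {g. \<sigma> g \<in> V n}" .
  show v: "W.is_val g n = V.is_val (\<sigma> g) n" for g n
    by (simp add: W.is_val_def V.is_val_def)
  have "\<sigma> (\<tau> g) = g" for g using c by (simp add: coord_change_def)
  thus "W.val_set = V.val_set"
    unfolding W.val_set_def V.val_set_def v by (metis (no_types))
qed

theorem adapted_coordinates:
  fixes f :: "'k::alg_closed_field fps2"
  assumes "irreducible f" "f \<in> ord_ge 2"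
  obtains \<tau> \<sigma> V a b where "coord_change \<tau> \<sigma>" "branch_filtration (\<tau> f) V"
    "branch_filtration.is_val V var_x a" "branch_filtration.is_val V var_y b" "\<not> a dvd b" "a \<le> b"
    "branch_filtration.val_set V = value_semigroup f"
proof -
  obtain V0 where V0: "branch_filtration f V0" using branch_filtration_exists[OF assms] by blast
  interpret V0: branch_filtration f V0 by fact
  obtain m where m: "V0.is_val var_x m" by (metis V0.is_val_var_x)
  have "\<not> f dvd var_y" by (rule V0.not_dvd_of_linear_term) (simp add: var_y_nth)
  then obtain n where n: "V0.is_val var_y n" using V0.is_val_exists by blast
  \<comment> \<open>If necessary the variables are swapped, so that x has the smaller value.\<close>
  have "\<exists>\<tau> \<sigma> :: 'k fps2 \<Rightarrow> _. \<exists>a. coord_change \<tau> \<sigma> \<and> V0.is_val (\<sigma> var_x) a \<and> \<sigma> var_y \<in> V0 a"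
  proof (cases "m \<le> n")
    case True
    thus ?thesis using m n coord_change_id V0.V_antimono[OF True] unfolding V0.is_val_def by blast
  next
    case False
    hence "n \<le> m" by simp
    hence "coord_change swap_xy (swap_xy :: 'k fps2 \<Rightarrow> _) \<and> V0.is_val (swap_xy var_x) n \<and> swap_xy var_y \<in> V0 n"
      using m n V0.V_antimono[OF \<open>n \<le> m\<close>] by (simp add: coord_change_swap swap_xy V0.is_val_def)
    thus ?thesis by blast
  qed
  then obtain \<tau>\<^sub>1 \<sigma>\<^sub>1 :: "'k fps2 \<Rightarrow> 'k fps2" and a where
    c1: "coord_change \<tau>\<^sub>1 \<sigma>\<^sub>1" and a: "V0.is_val (\<sigma>\<^sub>1 var_x) a" "\<sigma>\<^sub>1 var_y \<in> V0 a" by blast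
  define V1 where "V1 n = {g. \<sigma>\<^sub>1 g \<in> V0 n}" for n
  note V1 = coord_change_filtration[OF V0 c1, folded V1_def]
  interpret V1: branch_filtration "\<tau>\<^sub>1 f" V1 by (fact V1(1))
  have a1: "V1.is_val var_x a" "var_y \<in> V1 a" using a by (simp_all add: V1(2)) (simp add: V1_def)
  obtain q b where q: "q $ 0 = 0" "V1.is_val (var_y - fps_const q) b" "\<not> a dvd b"
    using V1.shear_exists[OF a1] by blast
  let ?t = "subst_y (var_y + fps_const q)" and ?s = "subst_y (var_y - fps_const q)"
  note c2 = coord_change_shear[OF q(1)]
  define V2 where "V2 n = {g. ?s g \<in> V1 n}" for n
  note V2 = coord_change_filtration[OF V1(1) c2, folded V2_def]
  have l: "var_y - fps_const q \<in> ord_ge 1" using q(1) by (auto simp: wt_ge_def var_y_nth)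
  show thesis
  proof (rule that[OF coord_change_comp[OF c2 c1] V2(1)])
    show "branch_filtration.is_val V2 var_x a" unfolding V2(2) by (simp add: subst_y[OF l] a1)
    show "branch_filtration.is_val V2 var_y b" unfolding V2(2) by (simp add: subst_y[OF l] q)
    show "\<not> a dvd b" by fact
    have "b > 0" using V1.is_val_pos[OF q(2)] q(1) by (simp add: var_y_nth)
    \<comment> \<open>Subtracting q cannot push the value of y below a, since q has no constant term
      and is a multiple of x.\<close>
    have "fps_const q \<in> V1 a"
    proof (cases "q = 0")
      case False
      then obtain r u where "fps_const q = u * var_x ^ r" "u dvd 1" by (rule fps_const_decomp)
      have "r \<noteq> 0"
      proof
        assume "r = 0"
        with \<open>fps_const q = u * var_x ^ r\<close> \<open>u dvd 1\<close> have "fps_const q dvd 1" by simp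
        thus False using q(1) by (simp add: unit_fps2_iff)
      qed
      then obtain k where "r = Suc k" by (cases r) auto
      thus ?thesis using a1 \<open>fps_const q = u * var_x ^ r\<close>
        by (auto simp: V1.is_val_def intro: V1.V_mult_left V1.V_mult_right)
    qed (use V1.V_zero in simp)
    thus "a \<le> b" by (intro V1.is_val_ge[OF q(2)] V1.V_diff a1)
    show "branch_filtration.val_set V2 = value_semigroup f"
      using V2(3) V1(3) V0.value_semigroup_eq by simp
  qed
qed

section \<open>The Newton polygon in adapted coordinates\<close>

definition monom2 :: "nat \<times> nat \<Rightarrow> 'k::comm_ring_1 fps2" where
  "monom2 p = var_x ^ fst p * var_y ^ snd p"

lemma monom2_nth: "monom2 (k, l) $ j $ i = (if i = k \<and> j = l then 1 else 0)"
  unfolding monom2_def by (simp only: fst_conv snd_conv monom_nth)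

definition wt_box :: "nat \<Rightarrow> nat \<Rightarrow> nat \<Rightarrow> (nat \<times> nat) set" where
  "wt_box a b M = {p. a * fst p + b * snd p < M}"

lemma wt_box_bounds:
  assumes "a > 0" "b > 0" "p \<in> wt_box a b M"
  shows "fst p < M" "snd p < M"
proof -
  have "fst p \<le> a * fst p" "snd p \<le> b * snd p" using assms(1,2) by simp_all
  moreover have "a * fst p + b * snd p < M" using assms(3) by (simp add: wt_box_def)
  ultimately show "fst p < M" "snd p < M" by linarith+
qed

lemma finite_wt_box:
  assumes "a > 0" "b > 0"
  shows "finite (wt_box a b M)"
  by (rule finite_subset[of _ "{..<M} \<times> {..<M}"]) (use wt_box_bounds[OF assms] in force)+

lemma wt_ge_truncate:
  assumes "a > 0" "b > 0"
  shows "F - (\<Sum>p\<in>wt_box a b M. cst (F $ snd p $ fst p) * monom2 p) \<in> wt_ge a b M"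
proof (rule wt_geI)
  fix i j assume ij: "a * i + b * j < M"
  have "(\<Sum>p\<in>wt_box a b M. cst (F $ snd p $ fst p) * monom2 p) $ j $ i =
      (\<Sum>p\<in>wt_box a b M. if p = (i, j) then F $ j $ i else 0)"
    unfolding fps_sum_nth cst_mult_nth
    by (intro sum.cong) (auto simp: monom2_nth split: prod.splits if_splits)
  also have "\<dots> = F $ j $ i"
    using ij by (subst sum.delta[OF finite_wt_box[OF assms]]) (simp add: wt_box_def)
  finally show "(F - (\<Sum>p\<in>wt_box a b M. cst (F $ snd p $ fst p) * monom2 p)) $ j $ i = 0" by simp
qed

text \<open>The monomials of weight below M not divisible by x^i0 y^j0 lie in i0 columns of height
  about M/b and j0 rows of length about M/a. The factor \<open>a * b\<close> clears
  denominators.\<close>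

lemma wt_box_hook_card:
  assumes "a > 0" "b > 0"
  shows "a * b * card {p \<in> wt_box a b M. \<not> (i0 \<le> fst p \<and> j0 \<le> snd p)} \<le>
    (a * i0 + b * j0) * M + a * b * (i0 + j0)"
proof -
  let ?S = "{p \<in> wt_box a b M. \<not> (i0 \<le> fst p \<and> j0 \<le> snd p)}"
  have sub: "?S \<subseteq> {..<i0} \<times> {..M div b} \<union> {..M div a} \<times> {..<j0}"
  proof
    fix p assume p: "p \<in> ?S"
    hence "a * fst p \<le> M" "b * snd p \<le> M" by (auto simp: wt_box_def)
    hence "fst p \<le> M div a" "snd p \<le> M div b"
      using assms by (simp_all add: less_eq_div_iff_mult_less_eq mult.commute)
    thus "p \<in> {..<i0} \<times> {..M div b} \<union> {..M div a} \<times> {..<j0}"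
      using p by (cases p) auto
  qed
  have "card ?S \<le> card ({..<i0} \<times> {..M div b} \<union> {..M div a} \<times> {..<j0})"
    by (rule card_mono[OF _ sub]) simp
  also have "\<dots> \<le> card ({..<i0} \<times> {..M div b}) + card ({..M div a} \<times> {..<j0})"
    by (rule card_Un_le)
  also have "\<dots> = i0 * Suc (M div b) + Suc (M div a) * j0" by simp
  finally have "a * b * card ?S \<le> a * b * (i0 * Suc (M div b) + Suc (M div a) * j0)"
    by (rule mult_le_mono2)
  also have "\<dots> = a * i0 * (b * (M div b)) + b * j0 * (a * (M div a)) + a * b * (i0 + j0)"
    by (simp add: algebra_simps)
  also have "\<dots> \<le> a * i0 * M + b * j0 * M + a * b * (i0 + j0)"
    by (intro add_mono mult_le_mono2) simp_all
  finally show ?thesis by (simp add: algebra_simps)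
qed

lemma subspace_span_mod:
  assumes "fps2.subspace W"
  shows "fps2.subspace {v. \<exists>u\<in>fps2.span B. v - u \<in> W}"
  unfolding fps2.subspace_def
proof (intro conjI ballI allI)
  show "0 \<in> {v. \<exists>u\<in>fps2.span B. v - u \<in> W}"
    using fps2.span_zero fps2.subspace_0[OF assms] by (intro CollectI bexI[of _ 0]) auto
next
  fix v w assume "v \<in> {v. \<exists>u\<in>fps2.span B. v - u \<in> W}" "w \<in> {v. \<exists>u\<in>fps2.span B. v - u \<in> W}"
  then obtain u u' where "u \<in> fps2.span B" "u' \<in> fps2.span B" "v - u \<in> W" "w - u' \<in> W" by blast
  moreover from this have "(v + w) - (u + u') \<in> W"
    using fps2.subspace_add[OF assms, of "v - u" "w - u'"] by (simp add: algebra_simps)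
  ultimately show "v + w \<in> {v. \<exists>u\<in>fps2.span B. v - u \<in> W}"
    using fps2.span_add by blast
next
  fix c v assume "v \<in> {v. \<exists>u\<in>fps2.span B. v - u \<in> W}"
  then obtain u where "u \<in> fps2.span B" "v - u \<in> W" by blast
  moreover from this have "scalar c v - scalar c u \<in> W"
    using fps2.subspace_scale[OF assms, of "v - u" c] by (simp add: fps2.scale_right_diff_distrib)
  ultimately show "scalar c v \<in> {v. \<exists>u\<in>fps2.span B. v - u \<in> W}"
    using fps2.span_scale by blast
qed

locale adapted_filtration = branch_filtration +
  fixes a b :: nat
  assumes val_x: "is_val var_x a" and val_y: "is_val var_y b"
begin

lemma a_pos: "a > 0" and b_pos: "b > 0"
  using is_val_pos[OF val_x] is_val_pos[OF val_y] by (simp_all add: var_x_nth var_y_nth)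

lemma is_val_monom2: "is_val (monom2 (i, j)) (a * i + b * j)"
  using is_val_mult[OF is_val_power[OF val_x, of i] is_val_power[OF val_y, of j]]
  by (simp add: monom2_def mult.commute)

text \<open>The filtration is not assumed closed under infinite sums; splitting off variables lowers
  the weight to 0 in finitely many steps.\<close>

lemma wt_ge_V: "F \<in> wt_ge a b W \<Longrightarrow> F \<in> V W"
proof (induction W arbitrary: F rule: less_induct)
  case (less W)
  show ?case
  proof (cases "W = 0")
    case False
    have F: "F = var_x * low_x F + var_y * low_y F"
      using low_decomp[of F] wt_geD[OF less.prems, of 0 0] False by (simp add: cst_simps)
    have "low_x F \<in> V (W - a)" "low_y F \<in> V (W - b)"
      using less.IH wt_ge_low[OF less.prems] a_pos b_pos False by simp_all
    moreover have "var_x \<in> V a" "var_y \<in> V b" using val_x val_y by (auto simp: is_val_def)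
    ultimately have "var_x * low_x F \<in> V (a + (W - a))" "var_y * low_y F \<in> V (b + (W - b))"
      using V_mult by blast+
    hence "var_x * low_x F \<in> V W" "var_y * low_y F \<in> V W"
      using V_antimono[of W "a + (W - a)"] V_antimono[of W "b + (W - b)"] by simp_all
    thus ?thesis using V_add F by metis
  qed (simp add: V_0)
qed

text \<open>
  Modulo $f$ and $V_M$, all monomials divisible by the leading monomial of the initial form of
  $f$ are redundant.
\<close>

lemma span_mod_V:
  assumes f: "f \<in> wt_ge a b W" and ij: "a * i0 + b * j0 = W" "f $ j0 $ i0 \<noteq> 0"
    and least: "\<And>i j. a * i + b * j = W \<Longrightarrow> f $ j $ i \<noteq> 0 \<Longrightarrow> i0 \<le> i"
  shows "\<exists>u\<in>fps2.span (monom2 ` {p \<in> wt_box a b M. \<not> (i0 \<le> fst p \<and> j0 \<le> snd p)}). v - u \<in> V M"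
proof -
  define B :: "'a fps2 set" where "B = monom2 ` {p \<in> wt_box a b M. \<not> (i0 \<le> fst p \<and> j0 \<le> snd p)}"
  define U where "U = {v. \<exists>u\<in>fps2.span B. v - u \<in> V M}"
  have sub: "fps2.subspace U" unfolding U_def by (rule subspace_span_mod) (rule subspace_V)
  have VU: "v \<in> U" if "v \<in> V M" for v
    unfolding U_def using that fps2.span_zero by (intro CollectI bexI[of _ 0]) auto
  have Ucst: "cst c * v \<in> U" if "v \<in> U" for c v
    using fps2.subspace_scale[OF sub that] by (simp add: scalar_conv_cst)
  \<comment> \<open>Monomials are treated from high weight to low, and at equal weight from large
    x-exponent to small.\<close>
  have monom2_U: "monom2 p \<in> U" for p
  proof (induction p rule: wf_induct[OF wf_measures[of "[\<lambda>p. M - (a * fst p + b * snd p), \<lambda>p. M - fst p]"]])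
    case (1 p)
    obtain l j where p: "p = (l, j)" by (cases p)
    show ?case
    proof (cases "p \<in> wt_box a b M")
      case False
      hence "monom2 p \<in> V M"
        using is_val_monom2[of l j] V_antimono[of M "a * l + b * j"] by (auto simp: p wt_box_def is_val_def)
      thus ?thesis by (rule VU)
    next
      case box: True
      show ?thesis
      proof (cases "i0 \<le> l \<and> j0 \<le> j")
        case False
        hence "monom2 p \<in> fps2.span B" using box by (intro fps2.span_base) (auto simp: B_def p)
        thus ?thesis unfolding U_def using V_zero by (intro CollectI bexI[of _ "monom2 p"]) auto
      next
        case True
        then obtain i' j' where lj: "l = i0 + i'" "j = j0 + j'" by (auto simp: le_iff_add)
        \<comment> \<open>This multiple of f has p as leading monomial. It vanishes modulo f, so it
          expresses p through monomials treated before.\<close>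
        define H where "H = var_x ^ i' * (var_y ^ j' * f)"
        have H_nth: "H $ m $ k = (if k < i' \<or> m < j' then 0 else f $ (m - j') $ (k - i'))" for k m
          unfolding H_def by (simp only: var_x_power_mult_nth var_y_power_mult_nth) simp
        have H_U: "H \<in> U" by (intro VU V_dvd) (simp add: H_def)
        let ?S = "\<Sum>q\<in>wt_box a b M. cst (H $ snd q $ fst q) * monom2 q"
        have "H - ?S \<in> U" by (intro VU wt_ge_V wt_ge_truncate a_pos b_pos)
        from fps2.subspace_diff[OF sub H_U this] have S: "?S \<in> U" by simp
        have rest: "(\<Sum>q\<in>wt_box a b M - {p}. cst (H $ snd q $ fst q) * monom2 q) \<in> U"
        proof (rule fps2.subspace_sum[OF sub])
          fix q assume q: "q \<in> wt_box a b M - {p}"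
          obtain k m where km: "q = (k, m)" by (cases q)
          show "cst (H $ snd q $ fst q) * monom2 q \<in> U"
          proof (cases "H $ m $ k = 0")
            case True
            thus ?thesis using fps2.subspace_0[OF sub] by (simp add: km cst_simps)
          next
            case False
            hence ge: "i' \<le> k" "j' \<le> m" and nz: "f $ (m - j') $ (k - i') \<noteq> 0"
              by (auto simp: H_nth not_less split: if_splits)
            obtain k' m' where k': "k = i' + k'" "m = j' + m'" using ge by (auto simp: le_iff_add)
            have nz: "f $ m' $ k' \<noteq> 0" using nz by (simp add: k')
            have W: "W \<le> a * k' + b * m'" using wt_geD[OF f, of k' m'] nz by (meson not_less)
            have lt: "a * k + b * m < M" "a * l + b * j < M" using q box by (auto simp: wt_box_def km p)
            have wt: "a * l + b * j = W + (a * i' + b * j')" "a * k + b * m = (a * k' + b * m') + (a * i' + b * j')"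
              using ij(1) by (simp_all add: lj k' algebra_simps)
            have "l < M" using wt_box_bounds[OF a_pos b_pos box] by (simp add: p)
            \<comment> \<open>At equal weight q comes from the initial form of f, where i0 is the
              least x-exponent; thus q has a larger x-exponent than p.\<close>
            have "(q, p) \<in> measures [\<lambda>p. M - (a * fst p + b * snd p), \<lambda>p. M - fst p]"
            proof (cases "W = a * k' + b * m'")
              case True
              hence "i0 \<le> k'" using least[of k' m'] nz by simp
              moreover have "k' \<noteq> i0"
              proof
                assume "k' = i0"
                hence "a * i0 + b * m' = a * i0 + b * j0" using True ij(1) by metis
                hence "m' = j0" using b_pos by simp
                thus False using q \<open>k' = i0\<close> by (simp add: km p lj k' add.commute)
              qed
              ultimately have "l < k" by (simp add: lj k')
              moreover have "a * k + b * m = a * l + b * j" using wt True by simp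
              ultimately show ?thesis using \<open>l < M\<close> by (simp add: km p)
            next
              case False
              hence "a * l + b * j < a * k + b * m" using W wt by linarith
              hence "M - (a * k + b * m) < M - (a * l + b * j)" using lt by linarith
              thus ?thesis by (simp add: km p)
            qed
            with 1 have "monom2 q \<in> U" by blast
            thus ?thesis by (rule Ucst)
          qed
        qed
        have "?S = cst (H $ j $ l) * monom2 p + (\<Sum>q\<in>wt_box a b M - {p}. cst (H $ snd q $ fst q) * monom2 q)"
          using sum.remove[OF finite_wt_box[OF a_pos b_pos] box, of "\<lambda>q. cst (H $ snd q $ fst q) * monom2 q"]
          by (simp add: p)
        with fps2.subspace_diff[OF sub S rest] have "cst (H $ j $ l) * monom2 p \<in> U" by simp
        moreover have "H $ j $ l = f $ j0 $ i0" by (simp add: H_nth lj)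
        ultimately have "cst (f $ j0 $ i0) * monom2 p \<in> U" by simp
        hence "cst (inverse (f $ j0 $ i0)) * (cst (f $ j0 $ i0) * monom2 p) \<in> U" by (rule Ucst)
        moreover have "cst (inverse (f $ j0 $ i0)) * (cst (f $ j0 $ i0) * monom2 p) = (monom2 p :: 'a fps2)"
          using ij(2) by (simp add: mult.assoc[symmetric] cst_simps(4)[symmetric] cst_simps)
        ultimately show ?thesis by simp
      qed
    qed
  qed
  have "v - (\<Sum>p\<in>wt_box a b M. cst (v $ snd p $ fst p) * monom2 p) \<in> U"
    by (intro VU wt_ge_V wt_ge_truncate a_pos b_pos)
  moreover have "(\<Sum>p\<in>wt_box a b M. cst (v $ snd p $ fst p) * monom2 p) \<in> U"
    by (intro fps2.subspace_sum[OF sub] Ucst monom2_U)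
  ultimately have "v \<in> U" using fps2.subspace_add[OF sub] by fastforce
  thus ?thesis by (simp add: U_def B_def)
qed

text \<open>
  The values below $M$ give $M - O(1)$ independent classes modulo $V_M$, while by
  \<open>span_mod_V\<close> the quotient is spanned by $WM/(ab) + O(1)$ monomials.
\<close>

theorem f_wt_ge: "f \<in> wt_ge a b (a * b)"
proof (rule ccontr)
  assume neg: "f \<notin> wt_ge a b (a * b)"
  \<comment> \<open>W = N - 1 will be the weight of the initial form of f, and i0 the least
    x-exponent occurring in it.\<close>
  define N where "N = (LEAST N. f \<notin> wt_ge a b N)"
  have N: "f \<notin> wt_ge a b N" unfolding N_def using neg by (rule LeastI)
  have "N \<le> a * b" unfolding N_def using neg by (rule Least_le)
  obtain W where W: "N = Suc W" using N by (cases N) auto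
  have f: "f \<in> wt_ge a b W" using not_less_Least[of W "\<lambda>N. f \<notin> wt_ge a b N"] W by (auto simp: N_def)
  define I where "I i \<longleftrightarrow> (\<exists>j. a * i + b * j = W \<and> f $ j $ i \<noteq> 0)" for i
  from N obtain i j where ij: "a * i + b * j < Suc W" "f $ j $ i \<noteq> 0" unfolding W by (auto simp: wt_ge_def)
  moreover have "\<not> a * i + b * j < W" using wt_geD[OF f] ij by blast
  ultimately have "I i" unfolding I_def by (intro exI[of _ j]) simp
  define i0 where "i0 = (LEAST i. I i)"
  have "I i0" unfolding i0_def using \<open>I i\<close> by (rule LeastI)
  then obtain j0 where j0: "a * i0 + b * j0 = W" "f $ j0 $ i0 \<noteq> 0" by (auto simp: I_def)
  have least: "i0 \<le> i" if "a * i + b * j = W" "f $ j $ i \<noteq> 0" for i j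
    unfolding i0_def using that by (intro Least_le) (auto simp: I_def)
  obtain C where C: "\<And>n. n \<ge> C \<Longrightarrow> n \<in> val_set" using val_set_cofinite by blast
  obtain e where e: "\<And>s. s \<in> val_set \<Longrightarrow> is_val (e s) s" using is_val_witness by blast
  \<comment> \<open>M exceeds the error terms of both counts: these add up to
    \<open>a * b * (C + i0 + j0)\<close>, whereas W < ab leaves a margin of M.\<close>
  define M where "M = a * b * (C + i0 + j0) + 1"
  let ?P = "{p \<in> wt_box a b M. \<not> (i0 \<le> fst p \<and> j0 \<le> snd p)}"
  let ?T = "val_set \<inter> {..<M}"
  have finP: "finite ?P" using finite_wt_box[OF a_pos b_pos] by simp
  have "card ?T \<le> card (monom2 ` ?P :: 'a fps2 set)"
  proof (rule card_le_of_independent_mod[OF subspace_V[of M]])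
    show "finite (monom2 ` ?P :: 'a fps2 set)" using finP by simp
    show "\<exists>u\<in>fps2.span (monom2 ` ?P). v - u \<in> V M" for v
      by (rule span_mod_V[OF f j0 least])
    show "finite ?T" by simp
    fix c s assume *: "(\<Sum>s\<in>?T. scalar (c s) (e s)) \<in> V M" "s \<in> ?T"
    show "c s = 0"
    proof (rule ccontr)
      assume "c s \<noteq> 0"
      with is_val_sum[of ?T e s c] e *(2) obtain t where
        "t \<in> ?T" "is_val (\<Sum>s\<in>?T. scalar (c s) (e s)) t" by (auto simp: scalar_conv_cst)
      thus False using is_val_ge[OF _ *(1)] by fastforce
    qed
  qed
  also have "\<dots> \<le> card ?P" by (rule card_image_le[OF finP])
  finally have "card ?T \<le> card ?P" .
  moreover have "M - C \<le> card ?T"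
  proof -
    have "card {C..<M} \<le> card ?T" by (rule card_mono) (use C in auto)
    thus ?thesis by simp
  qed
  ultimately have "M \<le> card ?P + C" by linarith
  hence "a * b * M \<le> a * b * (card ?P + C)" by (rule mult_le_mono2)
  also have "\<dots> = a * b * card ?P + a * b * C" by (simp only: distrib_left)
  also have "\<dots> \<le> (W * M + a * b * (i0 + j0)) + a * b * C"
    using wt_box_hook_card[OF a_pos b_pos, of M i0 j0] by (simp add: j0)
  also have "\<dots> = W * M + a * b * (C + i0 + j0)" by (simp add: algebra_simps)
  also have "\<dots> < W * M + M" by (simp add: M_def)
  also have "\<dots> = Suc W * M" by simp
  also have "\<dots> \<le> a * b * M" using \<open>N \<le> a * b\<close> W by (intro mult_le_mono1) simp
  finally show False by simp
qed

section \<open>The initial form when two values generate the semigroup\<close>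

lemma coprime_of_val_set:
  assumes "val_set = nat_span {a, b}"
  shows "coprime a b"
proof (rule coprimeI)
  fix d assume d: "d dvd a" "d dvd b"
  obtain C where C: "\<And>n. n \<ge> C \<Longrightarrow> n \<in> val_set" using val_set_cofinite by blast
  have "d dvd n" if "n \<in> val_set" for n
  proof -
    from that assms have "n \<in> nat_span {a, b}" by simp
    then obtain i j where "n = a * i + b * j" by (rule nat_span_pair)
    thus ?thesis using d by simp
  qed
  hence "d dvd C" "d dvd Suc C" using C by auto
  thus "d dvd 1" by (metis dvd_add_right_iff Suc_eq_plus1)
qed

lemma weight_ab_exponents:
  assumes "coprime a b" "a * i + b * j = a * b"
  shows "(i = b \<and> j = 0) \<or> (i = 0 \<and> j = a)"
proof -
  have "a dvd b * j" using assms(2) by (metis dvd_add_right_iff dvd_triv_left)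
  hence "a dvd j" using assms(1) coprime_dvd_mult_right_iff by blast
  then obtain k where k: "j = a * k" by (elim dvdE)
  have "a * (i + b * k) = a * b" using assms(2) by (simp add: k algebra_simps)
  hence *: "i + b * k = b" using a_pos by simp
  have "k \<le> 1"
  proof (rule ccontr)
    assume "\<not> k \<le> 1"
    hence "b * 2 \<le> b * k" by (intro mult_le_mono2) simp
    thus False using * b_pos by linarith
  qed
  hence "k = 0 \<or> k = 1" by auto
  thus ?thesis using * k by auto
qed

text \<open>
  When $x^b - c y^a$ has value above $ab$, it can be completed by terms of higher weight to an
  element of the ideal of $f$; so $f$ itself cannot have weight above $ab$.
\<close>

lemma f_not_wt_ge_Suc:
  assumes G: "val_set = nat_span {a, b}"
  shows "f \<notin> wt_ge a b (Suc (a * b))"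
proof
  assume f: "f \<in> wt_ge a b (Suc (a * b))"
  let ?W = "Suc (a * b)"
  obtain C where C: "\<And>n. n \<ge> C \<Longrightarrow> n \<in> val_set" using val_set_cofinite by blast
  have x: "is_val (monom2 (b, 0)) (a * b)" and y: "is_val (monom2 (0, a)) (a * b)"
    using is_val_monom2[of b 0] is_val_monom2[of 0 a] by (simp_all add: mult.commute)
  obtain c where c: "monom2 (b, 0) - cst c * monom2 (0, a) \<in> V ?W"
    using V_lead x y unfolding is_val_def by blast
  \<comment> \<open>Each value is attained by a monomial whose weight is that value, so removing
    values above ab introduces only monomials of weight above ab.\<close>
  have "\<forall>s\<in>val_set. \<exists>p. s = a * fst p + b * snd p"
  proof
    fix s assume "s \<in> val_set"
    with G have "s \<in> nat_span {a, b}" by simp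
    then obtain i j where "s = a * i + b * j" by (rule nat_span_pair)
    thus "\<exists>p. s = a * fst p + b * snd p" by (intro exI[of _ "(i, j)"]) simp
  qed
  then obtain p where p: "\<And>s. s \<in> val_set \<Longrightarrow> s = a * fst (p s) + b * snd (p s)"
    unfolding bchoice_iff by blast
  define e :: "nat \<Rightarrow> 'a fps2" where "e s = monom2 (p s)" for s
  have e: "is_val (e s) s" if "s \<in> val_set" for s
    using is_val_monom2[of "fst (p s)" "snd (p s)"] p[OF that] by (simp add: e_def)
  \<comment> \<open>A monomial of weight above ab: its multiples absorb the terms of large value and
    leave weight ab untouched.\<close>
  define g :: "'a fps2" where "g = monom2 (b, 1)"
  obtain n where n: "is_val g n" "n \<ge> ?W"
    using is_val_monom2[of b 1] b_pos unfolding g_def by fastforce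
  let ?I = "val_set \<inter> {?W..<?W + (n + C)}"
  obtain d where d: "monom2 (b, 0) - cst c * monom2 (0, a) - (\<Sum>s\<in>?I. cst (d s) * e s) \<in> V (?W + (n + C))"
    using V_approx[OF c, of "n + C" e] e by blast
  have "monom2 (b, 0) - cst c * monom2 (0, a) - (\<Sum>s\<in>?I. cst (d s) * e s) \<in> ideal_gen {f, g}"
    by (rule conductor_in_ideal[OF n(1) C]) (use V_antimono[OF _ d, of "n + C"] in auto)
  then obtain h r where hr:
      "monom2 (b, 0) - cst c * monom2 (0, a) - (\<Sum>s\<in>?I. cst (d s) * e s) - g * h = f * r"
    unfolding ideal_gen_pair dvd_def by blast
  have "(\<Sum>s\<in>?I. cst (d s) * e s) \<in> wt_ge a b ?W"
  proof (intro wt_ge_sum wt_ge_mult_left wt_geI)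
    fix s i j assume s: "s \<in> ?I" and ij: "a * i + b * j < ?W"
    have "\<not> (i = fst (p s) \<and> j = snd (p s))"
    proof
      assume "i = fst (p s) \<and> j = snd (p s)"
      thus False using p[of s] s ij by simp
    qed
    thus "e s $ j $ i = 0" using monom2_nth[of "fst (p s)" "snd (p s)" j i] by (auto simp: e_def)
  qed
  moreover have "g \<in> wt_ge a b ?W"
    unfolding g_def using b_pos by (intro wt_geI) (auto simp: monom2_nth)
  ultimately have "(\<Sum>s\<in>?I. cst (d s) * e s) + g * h + f * r \<in> wt_ge a b ?W"
    using f by (intro wt_ge_add wt_ge_mult_right)
  moreover have "(\<Sum>s\<in>?I. cst (d s) * e s) + g * h + f * r = monom2 (b, 0) - cst c * monom2 (0, a)"
    by (subst hr[symmetric]) (simp add: algebra_simps)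
  ultimately have "monom2 (b, 0) - cst c * monom2 (0, a) \<in> wt_ge a b ?W" by simp
  hence "(monom2 (b, 0) - cst c * monom2 (0, a)) $ 0 $ b = 0" by (rule wt_geD) simp
  moreover have "(monom2 (b, 0) - cst c * monom2 (0, a)) $ 0 $ b = 1"
    using a_pos b_pos by (simp only: fps_sub_nth cst_mult_nth monom2_nth) simp
  ultimately show False by simp
qed

text \<open>By coprimality x^b and y^a are the only monomials of weight ab. Their combination
  differs from f by higher weight, so its value exceeds ab. If just one coefficient vanished, the
  other term would have value exactly ab; both cannot vanish by
  \<open>f_not_wt_ge_Suc\<close>.\<close>

lemma f_initial_form:
  assumes G: "val_set = nat_span {a, b}"
  shows "f $ 0 $ b \<noteq> 0" "f $ a $ 0 \<noteq> 0"
    "f - (cst (f $ 0 $ b) * monom2 (b, 0) + cst (f $ a $ 0) * monom2 (0, a)) \<in> wt_ge a b (Suc (a * b))"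
proof -
  let ?x = "cst (f $ 0 $ b) * monom2 (b, 0)" and ?y = "cst (f $ a $ 0) * monom2 (0, a)"
  note cop = coprime_of_val_set[OF G]
  show *: "f - (?x + ?y) \<in> wt_ge a b (Suc (a * b))"
  proof (rule wt_geI)
    fix i j assume "a * i + b * j < Suc (a * b)"
    then consider "a * i + b * j < a * b" | "a * i + b * j = a * b" by linarith
    thus "(f - (?x + ?y)) $ j $ i = 0"
    proof cases
      case 1
      hence "\<not> (i = b \<and> j = 0)" "\<not> (i = 0 \<and> j = a)" by (auto simp: mult.commute)
      thus ?thesis using wt_geD[OF f_wt_ge 1] by (auto simp: monom2_nth)
    next
      case 2
      from weight_ab_exponents[OF cop this] show ?thesis
        using a_pos b_pos by (auto simp: monom2_nth)
    qed
  qed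
  have fV: "- f \<in> V n" for n by (intro V_minus V_dvd) simp
  have "is_val (monom2 (b, 0)) (a * b)" "is_val (monom2 (0, a)) (a * b)"
    using is_val_monom2[of b 0] is_val_monom2[of 0 a] by (simp_all add: mult.commute)
  moreover have "?x + ?y \<in> V (Suc (a * b))"
    using V_diff[OF V_dvd[of f] wt_ge_V[OF *]] by simp
  moreover have "\<not> (f $ 0 $ b = 0 \<and> f $ a $ 0 = 0)"
    using * f_not_wt_ge_Suc[OF G] by (auto simp: cst_simps)
  ultimately show "f $ 0 $ b \<noteq> 0" "f $ a $ 0 \<noteq> 0"
    using is_val_mult_unit[OF _ cst_unit] unfolding is_val_def
    by (metis add.left_neutral add.right_neutral cst_simps(1) mult_zero_left)+
qed

end

section \<open>F-pure thresholds\<close>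

lemma frob_power_iff:
  fixes F :: "'k::field fps2"
  shows "F \<in> frob_power e \<longleftrightarrow> (\<forall>i<CHAR('k) ^ e. \<forall>j<CHAR('k) ^ e. F $ j $ i = 0)"
proof -
  define q where "q = CHAR('k) ^ e"
  have "(\<exists>r s. F = r * var_x ^ q + s * var_y ^ q) \<longleftrightarrow> (\<forall>i<q. \<forall>j<q. F $ j $ i = 0)"
  proof
    assume "\<exists>r s. F = r * var_x ^ q + s * var_y ^ q"
    then obtain r s where "F = var_x ^ q * r + var_y ^ q * s" by (auto simp: mult.commute)
    thus "\<forall>i<q. \<forall>j<q. F $ j $ i = 0"
      by (simp only: fps_add_nth var_x_power_mult_nth var_y_power_mult_nth) simp
  next
    assume *: "\<forall>i<q. \<forall>j<q. F $ j $ i = 0"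
    define A where "A = Abs_fps (\<lambda>j. if j < q then fps_shift q (F $ j) else 0)"
    have "F = A * var_x ^ q + fps_shift q F * var_y ^ q"
    proof (rule fps2_eqI)
      fix i j
      show "F $ j $ i = (A * var_x ^ q + fps_shift q F * var_y ^ q) $ j $ i"
        using * by (simp only: fps_add_nth var_x_power_mult_nth var_y_power_mult_nth
            mult.commute[of _ "var_x ^ q"] mult.commute[of _ "var_y ^ q"]) (auto simp: A_def)
    qed
    thus "\<exists>r s. F = r * var_x ^ q + s * var_y ^ q" by blast
  qed
  thus ?thesis by (simp add: frob_power_def ideal_gen_insert2 q_def)
qed

lemma frob_power_decomp:
  fixes F :: "'k::field fps2"
  assumes "F \<in> frob_power e"
  obtains r s where "F = r * var_x ^ (CHAR('k) ^ e) + s * var_y ^ (CHAR('k) ^ e)"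
  using assms unfolding frob_power_def ideal_gen_insert2 by blast

lemma frob_power_add: "F \<in> frob_power e \<Longrightarrow> G \<in> frob_power e \<Longrightarrow> F + G \<in> frob_power e"
  by (simp add: frob_power_iff)

lemma frob_power_sum: "(\<And>s. s \<in> S \<Longrightarrow> F s \<in> frob_power e) \<Longrightarrow> sum F S \<in> frob_power e"
  by (induction S rule: infinite_finite_induct) (auto intro: frob_power_add simp: frob_power_iff)

lemma frob_power_mult_left: "G \<in> frob_power e \<Longrightarrow> F * G \<in> frob_power e"
proof -
  assume "G \<in> frob_power e"
  then obtain r s where "G = r * var_x ^ (CHAR('a) ^ e) + s * var_y ^ (CHAR('a) ^ e)"
    by (rule frob_power_decomp)
  hence "F * G = (F * r) * var_x ^ (CHAR('a) ^ e) + (F * s) * var_y ^ (CHAR('a) ^ e)"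
    by (simp add: algebra_simps)
  thus ?thesis unfolding frob_power_def ideal_gen_insert2 by blast
qed

lemma frob_power_var:
  "(var_x :: 'k::field fps2) ^ (CHAR('k) ^ e) \<in> frob_power e"
  "(var_y :: 'k::field fps2) ^ (CHAR('k) ^ e) \<in> frob_power e"
  using var_x_power_mult_nth[of "CHAR('k) ^ e" "1 :: 'k fps2"] var_y_power_mult_nth[of "CHAR('k) ^ e" "1 :: 'k fps2"]
  by (simp_all add: frob_power_iff)

locale pos_char =
  fixes dummy :: "'k::field itself"
  assumes CHAR_pos: "CHAR('k) > 0"
begin

lemma prime_CHAR: "prime CHAR('k)"
  using CHAR_pos by (rule prime_CHAR_semidom)

lemma q_pos: "CHAR('k) ^ e > 0"
  using CHAR_pos by simp

lemma frobenius_add: "(F + G :: 'k fps2) ^ (CHAR('k) ^ e) = F ^ (CHAR('k) ^ e) + G ^ (CHAR('k) ^ e)"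
  by (rule freshmans_dream') (simp_all add: prime_CHAR)

lemma frob_power_of_ord_ge:
  assumes "(F :: 'k fps2) \<in> ord_ge 1"
  shows "F ^ (CHAR('k) ^ e) \<in> frob_power e"
proof -
  obtain A B where "F = var_x * A + var_y * B"
    using ord_ge_Suc_decomp[of F 0] assms by auto
  hence "F ^ (CHAR('k) ^ e) = A ^ (CHAR('k) ^ e) * var_x ^ (CHAR('k) ^ e) + B ^ (CHAR('k) ^ e) * var_y ^ (CHAR('k) ^ e)"
    by (simp add: frobenius_add power_mult_distrib mult.commute)
  thus ?thesis by (simp add: frob_power_add frob_power_mult_left frob_power_var)
qed

text \<open>The images of x^q and y^q are q-th powers of elements of the maximal ideal, and
  Frobenius is additive. Hence the threshold does not depend on coordinates.\<close>

lemma alg_hom_frob_power: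
  assumes "alg_hom \<theta>" "\<theta> var_x \<in> ord_ge 1" "\<theta> var_y \<in> ord_ge 1" "(F :: 'k fps2) \<in> frob_power e"
  shows "\<theta> F \<in> frob_power e"
proof -
  obtain r s where "F = r * var_x ^ (CHAR('k) ^ e) + s * var_y ^ (CHAR('k) ^ e)"
    using assms(4) by (rule frob_power_decomp)
  thus ?thesis
    using frob_power_of_ord_ge[OF assms(2), of e] frob_power_of_ord_ge[OF assms(3), of e]
    by (simp add: alg_hom_simps[OF assms(1)] frob_power_add frob_power_mult_left)
qed

text \<open>Monomials with both exponents below q have degree below 2q. This makes the
  \<open>GREATEST\<close> in \<open>nu\<close> meaningful and bounds the sequence defining
  \<open>fpt\<close>.\<close>

lemma power_not_in_frob_power_bound:
  assumes "(h :: 'k fps2) \<in> ord_ge 1" "h ^ N \<notin> frob_power e"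
  shows "N < 2 * CHAR('k) ^ e"
proof (rule ccontr)
  assume *: "\<not> N < 2 * CHAR('k) ^ e"
  have "h ^ N \<in> ord_ge N" using wt_ge_power[OF assms(1), of N] by simp
  hence "h ^ N \<in> frob_power e"
    unfolding frob_power_iff using * by (auto intro!: wt_geD[of "h ^ N" 1 1 N])
  thus False using assms(2) by blast
qed

lemma nu_props:
  assumes "(h :: 'k fps2) \<in> ord_ge 1"
  shows "h ^ nu e h \<notin> frob_power e" "h ^ N \<notin> frob_power e \<Longrightarrow> N \<le> nu e h"
proof -
  have b: "\<forall>N. h ^ N \<notin> frob_power e \<longrightarrow> N \<le> 2 * CHAR('k) ^ e"
    using power_not_in_frob_power_bound[OF assms] by (auto intro: less_imp_le)
  have "h ^ 0 \<notin> frob_power e"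
    using q_pos[of e] by (auto simp: frob_power_iff intro!: exI[of _ 0])
  thus "h ^ nu e h \<notin> frob_power e"
    unfolding nu_def by (rule GreatestI_nat[where P = "\<lambda>N. h ^ N \<notin> frob_power e"]) (use b in blast)
  show "N \<le> nu e h" if "h ^ N \<notin> frob_power e"
    unfolding nu_def using that by (rule Greatest_le_nat[where P = "\<lambda>N. h ^ N \<notin> frob_power e"]) (use b in blast)
qed

text \<open>Regularity of the ring enters here: Frobenius is flat.\<close>

lemma frob_power_Suc:
  assumes "(F :: 'k fps2) \<notin> frob_power e"
  shows "F ^ CHAR('k) \<notin> frob_power (Suc e)"
proof -
  define p q where "p = CHAR('k)" and "q = p ^ e"
  have p: "p > 0" using CHAR_pos by (simp add: p_def)
  from assms obtain i j where ij: "i < q" "j < q" "F $ j $ i \<noteq> 0"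
    by (auto simp: frob_power_iff p_def q_def)
  \<comment> \<open>The polynomial P represents F modulo x^q and y^q. Its p-th power is taken term
    by term, and the resulting monomials remain distinct.\<close>
  define P where "P = (\<Sum>r\<in>{..<q} \<times> {..<q}. cst (F $ snd r $ fst r) * monom2 r)"
  have P_nth: "P $ m $ l = F $ m $ l" if "l < q" "m < q" for l m
  proof -
    have "P $ m $ l = (\<Sum>r\<in>{..<q} \<times> {..<q}. if r = (l, m) then F $ m $ l else 0)"
      unfolding P_def fps_sum_nth cst_mult_nth
      by (intro sum.cong) (auto simp: monom2_nth split: prod.splits if_splits)
    thus ?thesis using that by (subst (asm) sum.delta) auto
  qed
  have "F - P \<in> frob_power e"
    using P_nth by (simp add: frob_power_iff flip: p_def q_def)
  then obtain r s where "F - P = r * var_x ^ q + s * var_y ^ q"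
    unfolding p_def q_def by (rule frob_power_decomp)
  hence "F = P + (r * var_x ^ q + s * var_y ^ q)" by (simp add: algebra_simps)
  hence "F ^ p = P ^ p + (r ^ p * var_x ^ (q * p) + s ^ p * var_y ^ (q * p))"
    using frobenius_add[of _ _ 1] by (simp add: p_def power_mult_distrib power_mult)
  moreover have "q * p = CHAR('k) ^ Suc e" by (simp add: q_def p_def)
  ultimately have diff: "F ^ p - P ^ p \<in> frob_power (Suc e)"
    by (simp only: add_diff_cancel_left') (intro frob_power_add frob_power_mult_left frob_power_var)
  have "P ^ p = (\<Sum>r\<in>{..<q} \<times> {..<q}. (cst (F $ snd r $ fst r) * monom2 r) ^ p)"
    unfolding P_def by (rule freshmans_dream_sum) (simp_all add: prime_CHAR p_def)
  also have "\<dots> = (\<Sum>r\<in>{..<q} \<times> {..<q}. cst ((F $ snd r $ fst r) ^ p) * monom2 (fst r * p, snd r * p))"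
    by (intro sum.cong) (simp_all add: power_mult_distrib monom2_def power_mult cst_def fps_const_power)
  finally have "(P ^ p) $ (j * p) $ (i * p) = (\<Sum>r\<in>{..<q} \<times> {..<q}. if r = (i, j) then (F $ j $ i) ^ p else 0)"
    unfolding fps_sum_nth cst_mult_nth
    using p by (simp only: fps_sum_nth cst_mult_nth)
       (intro sum.cong, auto simp: monom2_nth split: prod.splits if_splits)
  also have "\<dots> = (F $ j $ i) ^ p" using ij by (subst sum.delta) auto
  finally have nz: "(P ^ p) $ (j * p) $ (i * p) \<noteq> 0" using ij by simp
  have lt: "i * p < CHAR('k) ^ Suc e" "j * p < CHAR('k) ^ Suc e"
    using ij p by (simp_all add: p_def q_def mult.commute)
  show ?thesis
  proof
    assume "F ^ CHAR('k) \<in> frob_power (Suc e)"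
    hence "(F ^ p) $ (j * p) $ (i * p) = 0" using lt unfolding frob_power_iff p_def by blast
    moreover have "(F ^ p - P ^ p) $ (j * p) $ (i * p) = 0" using diff lt unfolding frob_power_iff by blast
    ultimately show False using nz by simp
  qed
qed

text \<open>\<open>frob_power_Suc\<close> makes the sequence increasing, and it is bounded by
  2.\<close>

lemma fpt_LIMSEQ:
  assumes "(h :: 'k fps2) \<in> ord_ge 1"
  shows "(\<lambda>e. real (nu e h) / real (CHAR('k) ^ e)) \<longlonglongrightarrow> fpt h"
proof -
  let ?X = "\<lambda>e. real (nu e h) / real (CHAR('k) ^ e)"
  have "incseq ?X"
  proof (rule incseq_SucI)
    fix e
    have "h ^ (nu e h * CHAR('k)) \<notin> frob_power (Suc e)"
      unfolding power_mult by (intro frob_power_Suc nu_props assms)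
    hence "nu e h * CHAR('k) \<le> nu (Suc e) h" by (rule nu_props(2)[OF assms])
    hence "real (nu e h) * real CHAR('k) \<le> real (nu (Suc e) h)"
      by (simp only: of_nat_mult[symmetric] of_nat_le_iff)
    thus "?X e \<le> ?X (Suc e)" using CHAR_pos by (simp add: field_simps)
  qed
  moreover have "\<forall>e. ?X e \<le> 2"
  proof
    fix e
    have "nu e h < 2 * CHAR('k) ^ e"
      by (rule power_not_in_frob_power_bound[OF assms nu_props(1)[OF assms]])
    hence "real (nu e h) \<le> 2 * real (CHAR('k) ^ e)" by linarith
    thus "?X e \<le> 2" using CHAR_pos by (simp add: field_simps)
  qed
  ultimately obtain L where "?X \<longlonglongrightarrow> L" by (rule incseq_convergent)
  thus ?thesis unfolding fpt_def by (metis limI)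
qed

lemma fpt_mono:
  assumes "(g :: 'k fps2) \<in> ord_ge 1" "(h :: 'k fps2) \<in> ord_ge 1"
    and "\<And>e N. g ^ N \<notin> frob_power e \<Longrightarrow> h ^ N \<notin> frob_power e"
  shows "fpt g \<le> fpt h"
proof (rule LIMSEQ_le[OF fpt_LIMSEQ[OF assms(1)] fpt_LIMSEQ[OF assms(2)]])
  have "nu e g \<le> nu e h" for e
    by (intro nu_props(2) assms nu_props(1))
  thus "\<exists>N. \<forall>n\<ge>N. real (nu n g) / real (CHAR('k) ^ n) \<le> real (nu n h) / real (CHAR('k) ^ n)"
    by (intro exI[of _ 0] allI impI divide_right_mono) auto
qed

lemma fpt_coord_change:
  assumes "coord_change \<tau> \<sigma>" "(h :: 'k fps2) \<in> ord_ge 1"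
  shows "fpt (\<tau> h) = fpt h"
proof -
  have \<tau>: "alg_hom \<tau>" "\<tau> var_x \<in> ord_ge 1" "\<tau> var_y \<in> ord_ge 1"
    and \<sigma>: "alg_hom \<sigma>" "\<sigma> var_x \<in> ord_ge 1" "\<sigma> var_y \<in> ord_ge 1" and inv: "\<And>g. \<sigma> (\<tau> g) = g"
    using assms(1) by (simp_all add: coord_change_def)
  have "(\<tau> h) ^ N \<in> frob_power e \<longleftrightarrow> h ^ N \<in> frob_power e" for N e
    using alg_hom_frob_power[OF \<tau>, of "h ^ N" e] alg_hom_frob_power[OF \<sigma>, of "\<tau> (h ^ N)" e] inv
    by (auto simp: alg_hom_simps[OF \<tau>(1)] alg_hom_simps[OF \<sigma>(1)])
  hence "nu e (\<tau> h) = nu e h" for e by (simp add: nu_def)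
  thus ?thesis by (simp add: fpt_def)
qed

text \<open>A monomial with both exponents below q has weight at most (a + b)q, while the monomials
  of h^N have weight at least Nab.\<close>

lemma fpt_le_of_wt_ge:
  assumes "(h :: 'k fps2) \<in> wt_ge a b (a * b)" "h \<in> ord_ge 1" "a > 0" "b > 0"
  shows "fpt h \<le> 1 / real a + 1 / real b"
proof (rule LIMSEQ_le_const2[OF fpt_LIMSEQ[OF assms(2)]])
  have "real (nu e h) / real (CHAR('k) ^ e) \<le> 1 / real a + 1 / real b" for e
  proof -
    let ?N = "nu e h" and ?q = "CHAR('k) ^ e"
    obtain i j where ij: "i < ?q" "j < ?q" "(h ^ ?N) $ j $ i \<noteq> 0"
      using nu_props(1)[OF assms(2), of e] unfolding frob_power_iff by blast
    hence "\<not> a * i + b * j < ?N * (a * b)" using wt_geD[OF wt_ge_power[OF assms(1)]] by blast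
    moreover have "a * i \<le> a * ?q" "b * j \<le> b * ?q" using ij by simp_all
    ultimately have "?N * (a * b) \<le> a * ?q + b * ?q" by linarith
    hence "?N * (a * b) \<le> (a + b) * ?q" by (simp only: add_mult_distrib)
    hence "real (?N * (a * b)) \<le> real ((a + b) * ?q)" by (simp only: of_nat_le_iff)
    hence "real ?N * (real a * real b) \<le> (real a + real b) * real ?q" by simp
    thus ?thesis using assms(3,4) q_pos[of e] by (simp add: field_simps)
  qed
  thus "\<exists>N. \<forall>n\<ge>N. real (nu n h) / real (CHAR('k) ^ n) \<le> 1 / real a + 1 / real b" by blast
qed

text \<open>
  A monomial of $(x^a + y^b)^N$ outside $\mathfrak{m}^{[q]}$ yields, up to swapping the variables
  and a nonzero factor, a monomial in the initial form of $h^N$.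
\<close>

lemma fpt_binomial_le:
  assumes h: "(h :: 'k fps2) - (cst c * monom2 (b, 0) + cst d * monom2 (0, a)) \<in> wt_ge a b (Suc (a * b))"
    and "c \<noteq> 0" "d \<noteq> 0" "h \<in> ord_ge 1" and ab: "a > 0" "b > 0"
  shows "fpt (var_x ^ a + var_y ^ b :: 'k fps2) \<le> fpt h"
proof (rule fpt_mono)
  have "var_x ^ a \<in> ord_ge (a * 1)" "var_y ^ b \<in> ord_ge (b * 1)" by (intro wt_ge_power wt_ge_var)+
  thus "(var_x ^ a + var_y ^ b :: 'k fps2) \<in> ord_ge 1"
    using ab by (intro wt_ge_add) (auto intro: wt_ge_mono)
  show "h \<in> ord_ge 1" by fact
  fix e N
  let ?q = "CHAR('k) ^ e"
  assume nin: "(var_x ^ a + var_y ^ b :: 'k fps2) ^ N \<notin> frob_power e"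
  have "(var_x ^ a + var_y ^ b :: 'k fps2) ^ N =
      (\<Sum>k\<le>N. cst (of_nat (N choose k)) * monom2 (a * k, b * (N - k)))"
    by (simp add: binomial_ring monom2_def power_mult cst_def fps_of_nat mult.assoc)
  then obtain k where k: "k \<le> N" "cst (of_nat (N choose k)) * monom2 (a * k, b * (N - k)) \<notin> (frob_power e :: 'k fps2 set)"
    using nin frob_power_sum[of "{..N}" _ e] by (metis (no_types, lifting) atMost_iff)
  then obtain i j where ij: "i < ?q" "j < ?q"
      "(cst (of_nat (N choose k)) * monom2 (a * k, b * (N - k)) :: 'k fps2) $ j $ i \<noteq> 0"
    unfolding frob_power_iff by blast
  hence ij': "i = a * k" "j = b * (N - k)" "of_nat (N choose k) \<noteq> (0 :: 'k)"
    unfolding cst_mult_nth monom2_nth by (auto split: if_splits)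
  define g where "g = cst c * monom2 (b, 0) + cst d * monom2 (0, a)"
  have gw: "g \<in> wt_ge a b (a * b)"
    unfolding g_def by (rule wt_geI) (auto simp: monom2_nth mult.commute)
  \<comment> \<open>Terms of h of weight above ab do not reach the part of h^n of weight
    nab.\<close>
  have diff: "h ^ n - g ^ n \<in> wt_ge a b (Suc (n * (a * b)))" for n
  proof (induction n)
    case (Suc n)
    have hw: "h \<in> wt_ge a b (a * b)"
      using wt_ge_add[OF wt_ge_mono[OF h] gw] by (simp add: g_def)
    have "h * (h ^ n - g ^ n) \<in> wt_ge a b (a * b + Suc (n * (a * b)))"
      by (intro wt_ge_mult hw Suc)
    moreover have "(h - g) * g ^ n \<in> wt_ge a b (Suc (a * b) + n * (a * b))"
      by (intro wt_ge_mult wt_ge_power gw) (use h in \<open>simp add: g_def\<close>)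
    ultimately have "h * (h ^ n - g ^ n) + (h - g) * g ^ n \<in> wt_ge a b (Suc (Suc n * (a * b)))"
      by (intro wt_ge_add) simp_all
    moreover have "h * (h ^ n - g ^ n) + (h - g) * g ^ n = h ^ Suc n - g ^ Suc n"
      by (simp add: algebra_simps)
    ultimately show ?case by simp
  qed simp
  have "g ^ N = (\<Sum>l\<le>N. cst (of_nat (N choose l) * c ^ l * d ^ (N - l)) * monom2 (b * l, a * (N - l)))"
    unfolding g_def binomial_ring
    by (intro sum.cong)
       (simp_all add: monom2_def power_mult_distrib power_mult cst_def fps_of_nat fps_const_power
         flip: fps_const_mult)
  hence "(g ^ N) $ i $ j = (\<Sum>l\<le>N. (of_nat (N choose l) * c ^ l * d ^ (N - l)) * (monom2 (b * l, a * (N - l)) $ i $ j))"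
    by (simp only: fps_sum_nth cst_mult_nth)
  \<comment> \<open>Different l give different monomials, so nothing cancels. The monomial with
    exponents i and j interchanged belongs to l = N - k, whose binomial coefficient is that of
    k.\<close>
  also have "\<dots> = (\<Sum>l\<le>N. if l = N - k then of_nat (N choose l) * c ^ l * d ^ (N - l) else 0)"
  proof (intro sum.cong refl)
    fix l assume "l \<in> {..N}"
    thus "(of_nat (N choose l) * c ^ l * d ^ (N - l)) * (monom2 (b * l, a * (N - l)) $ i $ j) =
        (if l = N - k then of_nat (N choose l) * c ^ l * d ^ (N - l) else 0)"
      using ab k(1) unfolding monom2_nth ij' by auto
  qed
  also have "\<dots> = of_nat (N choose (N - k)) * c ^ (N - k) * d ^ (N - (N - k))" by simp
  finally have nz: "(g ^ N) $ i $ j \<noteq> 0"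
    using ij' k(1) assms(2,3) by (simp add: binomial_symmetric[symmetric])
  have "a * j + b * i = N * (a * b)"
  proof -
    have "a * j + b * i = (a * b) * (N - k + k)" by (simp only: ij' algebra_simps)
    thus ?thesis using k(1) by simp
  qed
  hence "(h ^ N - g ^ N) $ i $ j = 0" by (intro wt_geD[OF diff]) simp
  hence "(h ^ N) $ i $ j \<noteq> 0" using nz by simp
  thus "h ^ N \<notin> frob_power e" unfolding frob_power_iff using ij by blast
qed

end

theorem theorem1p2:
  fixes f :: "'k::alg_closed_field fps2"
    and \<beta>\<^sub>0 \<beta>\<^sub>1 :: nat
  assumes "CHAR('k) > 0"
    and "f \<in> max_ideal_sq"
    and "irreducible f"
    and "\<beta>\<^sub>0 = min_gen_seq (value_semigroup f) 0"
    and "\<beta>\<^sub>1 = min_gen_seq (value_semigroup f) 1"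
  shows "fpt f \<le> 1 / real \<beta>\<^sub>0 + 1 / real \<beta>\<^sub>1 \<and>
    (value_semigroup f = nat_span {\<beta>\<^sub>0, \<beta>\<^sub>1} \<longrightarrow>
       fpt (var_x ^ \<beta>\<^sub>0 + var_y ^ \<beta>\<^sub>1 :: 'k fps2) \<le> fpt f \<and>
       fpt f \<le> 1 / real \<beta>\<^sub>0 + 1 / real \<beta>\<^sub>1 \<and>
       (fpt (var_x ^ \<beta>\<^sub>0 + var_y ^ \<beta>\<^sub>1 :: 'k fps2) = 1 / real \<beta>\<^sub>0 + 1 / real \<beta>\<^sub>1 \<longrightarrow>
          fpt f = fpt (var_x ^ \<beta>\<^sub>0 + var_y ^ \<beta>\<^sub>1 :: 'k fps2)))"
proof -
  interpret pos_char "TYPE('k)" by standard (fact assms(1))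
  have f2: "f \<in> ord_ge 2" by (rule max_ideal_sq_ord_ge) (fact assms(2))
  obtain \<tau> \<sigma> V a b where c: "coord_change \<tau> \<sigma>" and V: "branch_filtration (\<tau> f) V"
    and val: "branch_filtration.is_val V var_x a" "branch_filtration.is_val V var_y b"
    and ab: "\<not> a dvd b" "a \<le> b" and G: "branch_filtration.val_set V = value_semigroup f"
    using adapted_coordinates[OF assms(3) f2] by blast
  interpret branch_filtration "\<tau> f" V by fact
  interpret adapted_filtration "\<tau> f" V a b by standard (fact val)+
  have \<beta>: "\<beta>\<^sub>0 = a" "\<beta>\<^sub>1 = b"
    using min_gen_seq_val_set[OF val ab] assms(4,5) by (simp_all add: G)
  have f1: "f \<in> ord_ge 1" "\<tau> f \<in> ord_ge 1"
    using wt_ge_mono[OF f2] wt_ge_mono[OF f_ord] by simp_all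
  have fpt: "fpt (\<tau> f) = fpt f" by (rule fpt_coord_change[OF c f1(1)])
  have up: "fpt f \<le> 1 / real a + 1 / real b"
    using fpt_le_of_wt_ge[OF f_wt_ge f1(2) a_pos b_pos] by (simp add: fpt)
  have low: "fpt (var_x ^ a + var_y ^ b :: 'k fps2) \<le> fpt f" if "value_semigroup f = nat_span {a, b}"
  proof -
    have "val_set = nat_span {a, b}" using that G by simp
    note i = f_initial_form[OF this]
    show ?thesis using fpt_binomial_le[OF i(3,1,2) f1(2) a_pos b_pos] by (simp add: fpt)
  qed
  show ?thesis unfolding \<beta> using up low by auto
qed

end
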